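(* Let $(X, \mu, T)$ be an ergodic $\mathbb{Q}$-system. There is a family of injective group homomorphisms $\phi_k : \mathcal{E}_k(T) \to S^1 \times (\mathbb{A}/\mathbb{Q})^k$, $k \ge 0$, such that: (1) $\phi_0(c) = c$ for every $c \in S^1$; (2) for every $j \le k$ and $f \in \mathcal{E}_j(T)$, $\phi_k(f) = (\phi_j(f), \mathbf{0})$; (3) for every $k \in \mathbb{N}$ and $f \in \mathcal{E}_k(T)$, if $\phi_k(f) = (c, t_1, \ldots, t_k)$, then for every $q \in \mathbb{Q}$, \[ \phi_{k-1}(\Delta_q f) = \big(e_{\mathbb{Q}}(t'_0(q)),\ t'_1(q),\ \ldots,\ t'_{k-1}(q)\big), \quad\text{where } t'_i(q) = \sum_{j=i+1}^k \binom{q}{j-i} t_j. \]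
   Context: A $\mathbb{Q}$-system $(X,\mu,T)$: $X$ compact metric, $T$ an action of $(\mathbb{Q},+)$ by homeomorphisms, $\mu$ a $T$-invariant Borel probability measure; ergodic means invariant sets are null or conull. For $g\in L^\infty(\mu)$: $T^qg=g\circ T^q$, $\Delta_qg=\overline g\cdot T^qg$, $\Delta^k_{q_1,\dots,q_k}g=\Delta_{q_k}(\Delta^{k-1}_{q_1,\dots,q_{k-1}}g)$. $\mathcal{E}_k(T)$ is the set of phase polynomials of degree at most $k$: $g\in L^\infty(\mu)$ with $\Delta^{k+1}_{q_1,\dots,q_{k+1}}g=1$ a.e. for all $q_i\in\mathbb{Q}$; it is a group under pointwise multiplication, and $\mathcal{E}_0(T)$ is the set of constant functions with values in $S^1$ (identified with $S^1$). $\mathbb{A}$ is the ring of adeles; $\mathbb{A}/\mathbb{Q}$ is a compact group which is a $\mathbb{Q}$-vector space, and $e_{\mathbb{Q}}:\mathbb{A}/\mathbb{Q}\to S^1$ is the standard character such that every character of $\mathbb{Q}$ is $q\mapsto e_{\mathbb{Q}}(qx)$ for a unique $x$. $\binom{q}{j}=q(q-1)\cdots(q-j+1)/j!$. The group $S^1\times(\mathbb{A}/\mathbb{Q})^k$ has the product group structure. *)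

theory Defs
  imports
    "HOL-Probability.Probability_Measure"
    "HOL-Computational_Algebra.Primes"
    "HOL-Algebra.Product_Groups"
begin

section \<open>The \<open>p\<close>-adic absolute value on the rationals\<close>

definition padic_norm :: "nat \<Rightarrow> rat \<Rightarrow> real" where
  "padic_norm p x = (if x = 0 then 0 else
     real p powi (int (multiplicity (int p) (snd (quotient_of x)))
                  - int (multiplicity (int p) (fst (quotient_of x)))))"

lemma padic_norm_0 [simp]: "padic_norm p 0 = 0"
  by (simp add: padic_norm_def)

lemma padic_norm_nonneg [simp]: "0 \<le> padic_norm p x"
  by (simp add: padic_norm_def)

lemma padic_norm_frac:
  assumes p: "prime p" and "a \<noteq> 0" "b \<noteq> 0"
  shows "padic_norm p (of_int a / of_int b) =
    real p powi (int (multiplicity (int p) b) - int (multiplicity (int p) a))"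
proof -
  define x :: rat where "x = of_int a / of_int b"
  obtain n d where nd: "quotient_of x = (n, d)" by fastforce
  have d: "d > 0" using quotient_of_denom_pos[OF nd] .
  have x: "x = of_int n / of_int d" using quotient_of_div[OF nd] .
  have x0: "x \<noteq> 0" using assms by (simp add: x_def)
  hence n: "n \<noteq> 0" using x by auto
  have "(of_int (a * d) :: rat) = of_int (n * b)"
    using x d assms by (simp add: x_def field_simps)
  hence e: "a * d = n * b" by (simp only: of_int_eq_iff)
  have pe: "prime_elem (int p)" using p by simp
  have "multiplicity (int p) (a * d) = multiplicity (int p) (n * b)" using e by simp
  hence "multiplicity (int p) a + multiplicity (int p) d
       = multiplicity (int p) n + multiplicity (int p) b"
    using prime_elem_multiplicity_mult_distrib[OF pe] assms n d by simp
  hence e2: "int (multiplicity (int p) d) - int (multiplicity (int p) n)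
       = int (multiplicity (int p) b) - int (multiplicity (int p) a)"
    by linarith
  show ?thesis using x0 nd e2 unfolding x_def[symmetric] by (simp add: padic_norm_def)
qed

lemma padic_norm_mult:
  assumes p: "prime p"
  shows "padic_norm p (x * y) = padic_norm p x * padic_norm p y"
proof (cases "x = 0 \<or> y = 0")
  case True thus ?thesis by auto
next
  case False
  obtain a b where x: "x = of_int a / of_int b" "b \<noteq> 0"
    by (metis quotient_of_div quotient_of_denom_pos surj_pair less_irrefl)
  obtain c d where y: "y = of_int c / of_int d" "d \<noteq> 0"
    by (metis quotient_of_div quotient_of_denom_pos surj_pair less_irrefl)
  have ac: "a \<noteq> 0" "c \<noteq> 0" using False x y by auto
  have xy: "x * y = of_int (a * c) / of_int (b * d)" by (simp add: x y)
  have p0: "real p \<noteq> 0" using p by (simp add: prime_gt_0_nat)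
  have pe: "prime_elem (int p)" using p by simp
  show ?thesis
    unfolding xy unfolding x y
    using ac x y p0 p
    by (simp add: padic_norm_frac prime_elem_multiplicity_mult_distrib[OF pe]
         flip: power_int_add of_int_mult)
       (simp add: algebra_simps)
qed

lemma padic_norm_le_1_iff:
  assumes p: "prime p"
  shows "padic_norm p x \<le> 1 \<longleftrightarrow> (\<exists>a b. x = of_int a / of_int b \<and> \<not> int p dvd b)"
proof
  assume L: "padic_norm p x \<le> 1"
  obtain n d where nd: "quotient_of x = (n, d)" by fastforce
  have d: "d > 0" using quotient_of_denom_pos[OF nd] .
  have x: "x = of_int n / of_int d" using quotient_of_div[OF nd] .
  have cop: "coprime n d" using quotient_of_coprime[OF nd] .
  show "\<exists>a b. x = of_int a / of_int b \<and> \<not> int p dvd b"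
  proof (cases "int p dvd d")
    case False thus ?thesis using x by blast
  next
    case True
    have pp: "prime (int p)" using p by simp
    hence np: "\<not> int p dvd n" using True cop by (meson not_prime_unit coprime_common_divisor)
    hence n: "n \<noteq> 0" by auto
    have m0: "multiplicity (int p) n = 0" using np by (rule not_dvd_imp_multiplicity_0)
    have "multiplicity (int p) d > 0" using True d pp
      by (metis gr0I less_irrefl multiplicity_eq_zero_iff not_prime_unit)
    hence "padic_norm p x > 1"
      using padic_norm_frac[OF p n, of d] d x m0 prime_gt_1_nat[OF p] by simp
    thus ?thesis using L by simp
  qed
next
  assume "\<exists>a b. x = of_int a / of_int b \<and> \<not> int p dvd b"
  then obtain a b where x: "x = of_int a / of_int b" and b: "\<not> int p dvd b" by blast
  have b0: "b \<noteq> 0" using b by auto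
  show "padic_norm p x \<le> 1"
  proof (cases "a = 0")
    case False
    have "multiplicity (int p) b = 0" using b by (rule not_dvd_imp_multiplicity_0)
    hence "padic_norm p x = real p powi (- int (multiplicity (int p) a))"
      using padic_norm_frac[OF p False b0] x by simp
    also have "\<dots> \<le> 1"
      using prime_gt_1_nat[OF p] by (simp add: power_int_minus field_simps)
    finally show ?thesis .
  qed (simp add: x)
qed

lemma padic_norm_eq_0_iff:
  assumes "prime p" shows "padic_norm p x = 0 \<longleftrightarrow> x = 0"
  using prime_gt_0_nat[OF assms] by (simp add: padic_norm_def)

lemma padic_norm_minus [simp]:
  assumes "prime p" shows "padic_norm p (- x) = padic_norm p x"
proof -
  have "multiplicity (int p) (-1) = 0"
    using assms by (intro not_dvd_imp_multiplicity_0) auto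
  hence "padic_norm p (-1) = 1" using padic_norm_frac[OF assms, of "-1" 1] by simp
  thus ?thesis using padic_norm_mult[OF assms, of "-1" x] by simp
qed

lemma padic_norm_minus_commute:
  assumes "prime p" shows "padic_norm p (x - y) = padic_norm p (y - x)"
  using padic_norm_minus[OF assms, of "x - y"] by simp

lemma padic_norm_of_int: "prime p \<Longrightarrow> padic_norm p (of_int n) \<le> 1"
  unfolding padic_norm_le_1_iff by (rule exI[of _ n], rule exI[of _ 1]) auto

lemma padic_norm_ultra_aux:
  assumes p: "prime p" and le: "padic_norm p x \<le> padic_norm p y"
  shows "padic_norm p (x + y) \<le> padic_norm p y"
proof (cases "y = 0")
  case True thus ?thesis using le padic_norm_nonneg[of p x] by simp
next
  case False
  have y: "padic_norm p y > 0"
    using False padic_norm_eq_0_iff[OF p] padic_norm_nonneg[of p y] by (metis less_eq_real_def)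
  have "padic_norm p x = padic_norm p (x / y) * padic_norm p y"
    using False by (simp flip: padic_norm_mult[OF p])
  hence "padic_norm p (x / y) \<le> 1" using le y by simp
  then obtain a b where ab: "x / y = of_int a / of_int b" "\<not> int p dvd b"
    using padic_norm_le_1_iff[OF p] by blast
  hence "b \<noteq> 0" by auto
  hence "x / y + 1 = of_int (a + b) / of_int b" using ab by (simp add: field_simps)
  hence "padic_norm p (x / y + 1) \<le> 1" using ab padic_norm_le_1_iff[OF p] by blast
  moreover have "padic_norm p (x + y) = padic_norm p (x / y + 1) * padic_norm p y"
    using False by (simp add: distrib_right flip: padic_norm_mult[OF p])
  ultimately show ?thesis using y by simp
qed

lemma padic_norm_ultra:
  assumes p: "prime p"
  shows "padic_norm p (x + y) \<le> max (padic_norm p x) (padic_norm p y)"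
  using padic_norm_ultra_aux[OF p, of x y] padic_norm_ultra_aux[OF p, of y x]
  by (cases "padic_norm p x \<le> padic_norm p y") (auto simp: add.commute)

lemma padic_norm_ultra_le:
  assumes "prime p" "padic_norm p x \<le> e" "padic_norm p y \<le> e"
  shows "padic_norm p (x + y) \<le> e"
  using padic_norm_ultra[OF assms(1), of x y] assms by simp

lemma padic_norm_triangle:
  assumes "prime p" shows "padic_norm p (x + y) \<le> padic_norm p x + padic_norm p y"
  using padic_norm_ultra[OF assms, of x y] padic_norm_nonneg[of p x] padic_norm_nonneg[of p y]
  by linarith

lemma padic_norm_sum_le_1:
  assumes "prime p" "\<And>i. i \<in> I \<Longrightarrow> padic_norm p (f i) \<le> 1"
  shows "padic_norm p (sum f I) \<le> 1"
  using assms(2)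
  by (induction I rule: infinite_finite_induct) (auto intro!: padic_norm_ultra_le[OF assms(1)])

lemma all_padic_norm_le_1_imp_Ints:
  assumes "\<And>p. prime p \<Longrightarrow> padic_norm p x \<le> 1"
  shows "x \<in> \<int>"
proof -
  obtain n d where nd: "quotient_of x = (n, d)" by fastforce
  have d: "d > 0" using quotient_of_denom_pos[OF nd] .
  have x: "x = of_int n / of_int d" using quotient_of_div[OF nd] .
  have cop: "coprime n d" using quotient_of_coprime[OF nd] .
  have "d = 1"
  proof (rule ccontr)
    assume "d \<noteq> 1"
    hence "nat d \<noteq> 1" using d by simp
    then obtain p where p: "prime p" "p dvd nat d" using prime_factor_nat by blast
    hence pd: "int p dvd d" using d by (metis int_dvd_int_iff int_nat_eq less_le_not_le)
    obtain a b where ab: "x = of_int a / of_int b" "\<not> int p dvd b"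
      using assms[OF p(1)] padic_norm_le_1_iff[OF p(1)] by blast
    hence b: "b \<noteq> 0" by auto
    have "(of_int (a * d) :: rat) = of_int (n * b)"
      using ab(1) x b d by (simp add: field_simps)
    hence "a * d = n * b" by (simp only: of_int_eq_iff)
    hence "int p dvd n * b" using pd by (metis dvd_mult)
    hence "int p dvd n" using p(1) ab(2) by (simp add: prime_dvd_mult_iff)
    thus False using pd cop p(1) by (meson not_prime_unit coprime_common_divisor prime_nat_int_transfer)
  qed
  thus ?thesis using x by simp
qed

section \<open>The ring of adeles\<close>

definition padic_Cauchy :: "nat \<Rightarrow> (nat \<Rightarrow> rat) \<Rightarrow> bool" where
  "padic_Cauchy p s \<longleftrightarrow> (\<forall>e>0. \<exists>N. \<forall>m\<ge>N. \<forall>n\<ge>N. padic_norm p (s m - s n) < e)"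

definition padic_null :: "nat \<Rightarrow> (nat \<Rightarrow> rat) \<Rightarrow> bool" where
  "padic_null p s \<longleftrightarrow> (\<lambda>n. padic_norm p (s n)) \<longlonglongrightarrow> 0"

lemma padic_Cauchy_const [simp]: "padic_Cauchy p (\<lambda>_. c)"
  by (simp add: padic_Cauchy_def)

lemma padic_null_0 [simp]: "padic_null p (\<lambda>_. 0)"
  by (simp add: padic_null_def)

lemma padic_Cauchy_uminus:
  assumes "prime p" "padic_Cauchy p s" shows "padic_Cauchy p (\<lambda>n. - s n)"
proof -
  have "padic_norm p (- s m - - s n) = padic_norm p (s m - s n)" for m n
    using padic_norm_minus[OF assms(1), of "s m - s n"] by simp
  thus ?thesis using assms(2) by (simp add: padic_Cauchy_def)
qed

lemma padic_Cauchy_add: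
  assumes p: "prime p" and s: "padic_Cauchy p s" and t: "padic_Cauchy p t"
  shows "padic_Cauchy p (\<lambda>n. s n + t n)"
  unfolding padic_Cauchy_def
proof (intro allI impI)
  fix e :: real assume e: "e > 0"
  obtain N where N: "\<And>m n. m \<ge> N \<Longrightarrow> n \<ge> N \<Longrightarrow> padic_norm p (s m - s n) < e"
    using s e unfolding padic_Cauchy_def by blast
  obtain M where M: "\<And>m n. m \<ge> M \<Longrightarrow> n \<ge> M \<Longrightarrow> padic_norm p (t m - t n) < e"
    using t e unfolding padic_Cauchy_def by blast
  have "padic_norm p (s m + t m - (s n + t n)) < e"
    if "m \<ge> max M N" "n \<ge> max M N" for m n
    using padic_norm_ultra[OF p, of "s m - s n" "t m - t n"] N[of m n] M[of m n] that
    by (simp add: algebra_simps)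
  thus "\<exists>N. \<forall>m\<ge>N. \<forall>n\<ge>N. padic_norm p (s m + t m - (s n + t n)) < e" by blast
qed

lemma padic_Cauchy_bounded:
  assumes p: "prime p" and s: "padic_Cauchy p s"
  obtains B where "B > 0" "\<And>n. padic_norm p (s n) \<le> B"
proof -
  obtain N where N: "\<And>m n. m \<ge> N \<Longrightarrow> n \<ge> N \<Longrightarrow> padic_norm p (s m - s n) < 1"
    using s unfolding padic_Cauchy_def by (meson zero_less_one)
  define B where "B = 1 + (\<Sum>n\<le>N. padic_norm p (s n))"
  have le: "padic_norm p (s n) \<le> (\<Sum>n\<le>N. padic_norm p (s n))" if "n \<le> N" for n
    using that by (intro member_le_sum) auto
  have "padic_norm p (s n) \<le> B" for n
  proof (cases "n \<le> N")
    case True thus ?thesis using le[of n] by (simp add: B_def)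
  next
    case False
    have "padic_norm p (s n) \<le> padic_norm p (s n - s N) + padic_norm p (s N)"
      using padic_norm_triangle[OF p, of "s n - s N" "s N"] by simp
    also have "\<dots> \<le> B" using N[of n N] False le[of N] by (simp add: B_def)
    finally show ?thesis .
  qed
  moreover have "B > 0" unfolding B_def by (simp add: add_pos_nonneg sum_nonneg)
  ultimately show ?thesis by (intro that)
qed

lemma padic_Cauchy_mult:
  assumes p: "prime p" and s: "padic_Cauchy p s" and t: "padic_Cauchy p t"
  shows "padic_Cauchy p (\<lambda>n. s n * t n)"
  unfolding padic_Cauchy_def
proof (intro allI impI)
  fix e :: real assume e: "e > 0"
  obtain B where B: "B > 0" "\<And>n. padic_norm p (s n) \<le> B" using padic_Cauchy_bounded[OF p s] by blast
  obtain C where C: "C > 0" "\<And>n. padic_norm p (t n) \<le> C" using padic_Cauchy_bounded[OF p t] by blast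
  have eB: "e / B > 0" and eC: "e / C > 0" using e B(1) C(1) by auto
  obtain N where N: "\<And>m n. m \<ge> N \<Longrightarrow> n \<ge> N \<Longrightarrow> padic_norm p (s m - s n) < e / C"
    using s eC unfolding padic_Cauchy_def by blast
  obtain M where M: "\<And>m n. m \<ge> M \<Longrightarrow> n \<ge> M \<Longrightarrow> padic_norm p (t m - t n) < e / B"
    using t eB unfolding padic_Cauchy_def by blast
  have "padic_norm p (s m * t m - s n * t n) < e"
    if mn: "m \<ge> max M N" "n \<ge> max M N" for m n
  proof -
    have "padic_norm p (s m * (t m - t n)) = padic_norm p (s m) * padic_norm p (t m - t n)"
      by (rule padic_norm_mult[OF p])
    also have "\<dots> \<le> B * padic_norm p (t m - t n)" using B by (intro mult_right_mono) auto
    also have "\<dots> < B * (e / B)" using M[of m n] mn B by (intro mult_strict_left_mono) auto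
    finally have 1: "padic_norm p (s m * (t m - t n)) < e" using B by simp
    have "padic_norm p ((s m - s n) * t n) = padic_norm p (s m - s n) * padic_norm p (t n)"
      by (rule padic_norm_mult[OF p])
    also have "\<dots> \<le> padic_norm p (s m - s n) * C" using C by (intro mult_left_mono) auto
    also have "\<dots> < e / C * C" using N[of m n] mn C by (intro mult_strict_right_mono) auto
    finally have 2: "padic_norm p ((s m - s n) * t n) < e" using C by simp
    have "s m * t m - s n * t n = s m * (t m - t n) + (s m - s n) * t n"
      by (simp add: algebra_simps)
    thus ?thesis using 1 2 padic_norm_ultra[OF p, of "s m * (t m - t n)" "(s m - s n) * t n"]
      by simp
  qed
  thus "\<exists>N. \<forall>m\<ge>N. \<forall>n\<ge>N. padic_norm p (s m * t m - s n * t n) < e" by blast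
qed

lemma padic_null_uminus: "prime p \<Longrightarrow> padic_null p s \<Longrightarrow> padic_null p (\<lambda>n. - s n)"
  by (simp add: padic_null_def)

lemma padic_null_add:
  assumes p: "prime p" and "padic_null p s" "padic_null p t"
  shows "padic_null p (\<lambda>n. s n + t n)"
proof -
  have "(\<lambda>n. padic_norm p (s n) + padic_norm p (t n)) \<longlonglongrightarrow> 0"
    using assms(2,3) unfolding padic_null_def by (rule tendsto_add_zero)
  from tendsto_sandwich[OF _ _ tendsto_const this, of "\<lambda>n. padic_norm p (s n + t n)"]
  show ?thesis by (simp add: padic_null_def padic_norm_triangle[OF p])
qed

lemma padic_null_mult:
  assumes p: "prime p" and s: "padic_Cauchy p s" and t: "padic_null p t"
  shows "padic_null p (\<lambda>n. s n * t n)"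
proof -
  obtain B where B: "B > 0" "\<And>n. padic_norm p (s n) \<le> B" using padic_Cauchy_bounded[OF p s] by blast
  have "(\<lambda>n. B * padic_norm p (t n)) \<longlonglongrightarrow> 0"
    using t unfolding padic_null_def by (rule tendsto_mult_right_zero)
  moreover have "padic_norm p (s n * t n) \<le> B * padic_norm p (t n)" for n
    using B by (simp add: padic_norm_mult[OF p] mult_right_mono)
  ultimately show ?thesis
    using tendsto_sandwich[OF _ _ tendsto_const, of 0 "\<lambda>n. padic_norm p (s n * t n)"
      sequentially "\<lambda>n. B * padic_norm p (t n)"]
    by (simp add: padic_null_def)
qed

text \<open>
  \<open>\<rat>\<^sub>p\<close> is the completion of \<open>\<rat>\<close>: \<open>p\<close>-adic Cauchy sequences modulo \<open>p\<close>-adic null sequences.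
  The limit of a Cauchy sequence \<open>s\<close> lies in \<open>\<int>\<^sub>p\<close> iff \<open>padic_norm p (s n) \<le> 1\<close> for all large
  \<open>n\<close>. So a pair \<open>(r, x)\<close> satisfying \<open>adele_rep\<close> represents the element of the restricted
  product of \<open>\<real>\<close> and the \<open>\<rat>\<^sub>p\<close> (with respect to the \<open>\<int>\<^sub>p\<close>) with real component \<open>r\<close> and
  \<open>p\<close>-component \<open>lim x p\<close>; the values \<open>x p\<close> for non-prime \<open>p\<close> are irrelevant.
\<close>

definition adele_rep :: "real \<times> (nat \<Rightarrow> nat \<Rightarrow> rat) \<Rightarrow> bool" where
  "adele_rep a \<longleftrightarrow>
     (\<forall>p. prime p \<longrightarrow> padic_Cauchy p (snd a p)) \<and>
     finite {p. prime p \<and> \<not> (\<forall>\<^sub>F n in sequentially. padic_norm p (snd a p n) \<le> 1)}"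

definition adele_rel ::
    "real \<times> (nat \<Rightarrow> nat \<Rightarrow> rat) \<Rightarrow> real \<times> (nat \<Rightarrow> nat \<Rightarrow> rat) \<Rightarrow> bool" where
  "adele_rel a b \<longleftrightarrow> adele_rep a \<and> adele_rep b \<and> fst a = fst b \<and>
     (\<forall>p. prime p \<longrightarrow> padic_null p (\<lambda>n. snd a p n - snd b p n))"

lemma adele_rel_refl [simp]: "adele_rel a a \<longleftrightarrow> adele_rep a"
  by (simp add: adele_rel_def)

lemma adele_rep_const: "adele_rep (r, \<lambda>_ _. q)"
proof -
  have fin: "finite {p. prime p \<and> p dvd nat (snd (quotient_of q))}"
    using quotient_of_denom_pos'[of q]
    by (intro finite_subset[OF _ finite_divisors_nat[of "nat (snd (quotient_of q))"]]) auto
  have "padic_norm p q \<le> 1" if "prime p" "\<not> p dvd nat (snd (quotient_of q))" for p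
  proof -
    obtain a b where ab: "quotient_of q = (a, b)" by fastforce
    have "b > 0" using quotient_of_denom_pos[OF ab] .
    hence "\<not> int p dvd b" using that(2) ab by (metis int_dvd_int_iff int_nat_eq less_le_not_le snd_conv)
    thus ?thesis using quotient_of_div[OF ab] padic_norm_le_1_iff[OF that(1)] by blast
  qed
  hence "{p. prime p \<and> \<not> (\<forall>\<^sub>F n in sequentially. padic_norm p q \<le> 1)}
      \<subseteq> {p. prime p \<and> p dvd nat (snd (quotient_of q))}"
    by auto
  from finite_subset[OF this fin] show ?thesis by (simp add: adele_rep_def)
qed

quotient_type adele = "real \<times> (nat \<Rightarrow> nat \<Rightarrow> rat)" / partial: adele_rel
proof (rule part_equivpI)
  show "\<exists>x. adele_rel x x" using adele_rep_const by (intro exI) simp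
  show "symp adele_rel"
  proof (rule sympI)
    fix a b assume ab: "adele_rel a b"
    have "padic_null p (\<lambda>n. snd b p n - snd a p n)" if "prime p" for p
      using padic_null_uminus[OF that, of "\<lambda>n. snd a p n - snd b p n"] ab that
      by (simp add: adele_rel_def)
    thus "adele_rel b a" using ab by (simp add: adele_rel_def)
  qed
  show "transp adele_rel"
  proof (rule transpI)
    fix a b c assume ab: "adele_rel a b" and bc: "adele_rel b c"
    have "padic_null p (\<lambda>n. snd a p n - snd c p n)" if "prime p" for p
      using padic_null_add[OF that, of "\<lambda>n. snd a p n - snd b p n" "\<lambda>n. snd b p n - snd c p n"]
        ab bc that
      by (simp add: adele_rel_def)
    thus "adele_rel a c" using ab bc by (simp add: adele_rel_def)
  qed
qed

instantiation adele :: comm_ring_1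
begin

lift_definition zero_adele :: adele is "(0, \<lambda>_ _. 0)"
  by (simp add: adele_rep_const)

lift_definition one_adele :: adele is "(1, \<lambda>_ _. 1)"
  by (simp add: adele_rep_const)

lemma adele_rep_uminus: "adele_rep a \<Longrightarrow> adele_rep (- fst a, \<lambda>p n. - snd a p n)"
  by (simp add: adele_rep_def padic_Cauchy_uminus cong: conj_cong)

lemma adele_rep_add:
  assumes "adele_rep a" "adele_rep b"
  shows "adele_rep (fst a + fst b, \<lambda>p n. snd a p n + snd b p n)"
proof -
  let ?E = "\<lambda>x p. \<forall>\<^sub>F n in sequentially. padic_norm p (x p n) \<le> 1"
  have "{p. prime p \<and> \<not> ?E (\<lambda>p n. snd a p n + snd b p n) p}
      \<subseteq> {p. prime p \<and> \<not> ?E (snd a) p} \<union> {p. prime p \<and> \<not> ?E (snd b) p}"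
  proof -
    have "?E (\<lambda>p n. snd a p n + snd b p n) p"
      if "prime p" "?E (snd a) p" "?E (snd b) p" for p
      using that(2,3) by eventually_elim (rule padic_norm_ultra_le[OF that(1)])
    thus ?thesis by blast
  qed
  moreover have "finite \<dots>" using assms by (simp add: adele_rep_def)
  ultimately have "finite {p. prime p \<and> \<not> ?E (\<lambda>p n. snd a p n + snd b p n) p}"
    by (rule finite_subset)
  thus ?thesis using assms by (simp add: adele_rep_def padic_Cauchy_add)
qed

lemma adele_rep_mult:
  assumes "adele_rep a" "adele_rep b"
  shows "adele_rep (fst a * fst b, \<lambda>p n. snd a p n * snd b p n)"
proof -
  let ?E = "\<lambda>x p. \<forall>\<^sub>F n in sequentially. padic_norm p (x p n) \<le> 1"
  have "{p. prime p \<and> \<not> ?E (\<lambda>p n. snd a p n * snd b p n) p}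
      \<subseteq> {p. prime p \<and> \<not> ?E (snd a) p} \<union> {p. prime p \<and> \<not> ?E (snd b) p}"
  proof -
    have "?E (\<lambda>p n. snd a p n * snd b p n) p"
      if "prime p" "?E (snd a) p" "?E (snd b) p" for p
      using that(2,3)
      by eventually_elim (simp add: padic_norm_mult[OF that(1)] mult_le_one)
    thus ?thesis by blast
  qed
  moreover have "finite \<dots>" using assms by (simp add: adele_rep_def)
  ultimately have "finite {p. prime p \<and> \<not> ?E (\<lambda>p n. snd a p n * snd b p n) p}"
    by (rule finite_subset)
  thus ?thesis using assms by (simp add: adele_rep_def padic_Cauchy_mult)
qed

lift_definition uminus_adele :: "adele \<Rightarrow> adele" is
  "\<lambda>a. (- fst a, \<lambda>p n. - snd a p n)"
proof -
  fix a b assume ab: "adele_rel a b"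
  have "padic_null p (\<lambda>n. - snd a p n - - snd b p n)" if "prime p" for p
    using padic_null_uminus[OF that, of "\<lambda>n. snd a p n - snd b p n"] ab that
    by (simp add: adele_rel_def)
  thus "adele_rel (- fst a, \<lambda>p n. - snd a p n) (- fst b, \<lambda>p n. - snd b p n)"
    using ab adele_rep_uminus[of a] adele_rep_uminus[of b] by (simp add: adele_rel_def)
qed

lift_definition plus_adele :: "adele \<Rightarrow> adele \<Rightarrow> adele" is
  "\<lambda>a b. (fst a + fst b, \<lambda>p n. snd a p n + snd b p n)"
proof -
  fix a a' b b' assume ab: "adele_rel a a'" "adele_rel b b'"
  have "padic_null p (\<lambda>n. snd a p n + snd b p n - (snd a' p n + snd b' p n))" if "prime p" for p
    using padic_null_add[OF that, of "\<lambda>n. snd a p n - snd a' p n" "\<lambda>n. snd b p n - snd b' p n"]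
      ab that
    by (simp add: adele_rel_def algebra_simps)
  thus "adele_rel (fst a + fst b, \<lambda>p n. snd a p n + snd b p n)
      (fst a' + fst b', \<lambda>p n. snd a' p n + snd b' p n)"
    using ab adele_rep_add[of a b] adele_rep_add[of a' b'] by (simp add: adele_rel_def)
qed

lift_definition times_adele :: "adele \<Rightarrow> adele \<Rightarrow> adele" is
  "\<lambda>a b. (fst a * fst b, \<lambda>p n. snd a p n * snd b p n)"
proof -
  fix a a' b b' assume ab: "adele_rel a a'" "adele_rel b b'"
  have "padic_null p (\<lambda>n. snd a p n * snd b p n - snd a' p n * snd b' p n)" if p: "prime p" for p
  proof -
    have "padic_null p (\<lambda>n. snd a p n * (snd b p n - snd b' p n))"
      and "padic_null p (\<lambda>n. snd b' p n * (snd a p n - snd a' p n))"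
      using ab p by (auto intro!: padic_null_mult simp: adele_rel_def adele_rep_def)
    from padic_null_add[OF p this] show ?thesis by (simp add: algebra_simps)
  qed
  thus "adele_rel (fst a * fst b, \<lambda>p n. snd a p n * snd b p n)
      (fst a' * fst b', \<lambda>p n. snd a' p n * snd b' p n)"
    using ab adele_rep_mult[of a b] adele_rep_mult[of a' b'] by (simp add: adele_rel_def)
qed

definition minus_adele :: "adele \<Rightarrow> adele \<Rightarrow> adele" where
  "minus_adele a b = a + - b"

lemma adele_rel_eqI: "adele_rep a \<Longrightarrow> a = b \<Longrightarrow> adele_rel a b"
  by simp

lemmas adele_rep_intros =
  adele_rep_const
  adele_rep_uminus[of "(r, x)" for r x, unfolded fst_conv snd_conv]
  adele_rep_add[of "(r, x)" "(s, y)" for r x s y, unfolded fst_conv snd_conv]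
  adele_rep_mult[of "(r, x)" "(s, y)" for r x s y, unfolded fst_conv snd_conv]

instance
proof
  fix a b c :: adele
  show "a * b * c = a * (b * c)"
    by transfer (simp only: split_paired_all fst_conv snd_conv adele_rel_refl,
      rule adele_rel_eqI, (intro adele_rep_intros; assumption), simp add: mult.assoc)
  show "a * b = b * a"
    by transfer (simp only: split_paired_all fst_conv snd_conv adele_rel_refl,
      rule adele_rel_eqI, (intro adele_rep_intros; assumption), simp add: mult.commute)
  show "1 * a = a"
    by transfer simp
  show "a + b + c = a + (b + c)"
    by transfer (simp only: split_paired_all fst_conv snd_conv adele_rel_refl,
      rule adele_rel_eqI, (intro adele_rep_intros; assumption), simp add: add.assoc)
  show "a + b = b + a"
    by transfer (simp only: split_paired_all fst_conv snd_conv adele_rel_refl,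
      rule adele_rel_eqI, (intro adele_rep_intros; assumption), simp add: add.commute)
  show "0 + a = a"
    by transfer simp
  show "- a + a = 0"
    by transfer (simp add: adele_rep_const)
  show "a - b = a + - b"
    by (simp add: minus_adele_def)
  show "(a + b) * c = a * c + b * c"
    by transfer (simp only: split_paired_all fst_conv snd_conv adele_rel_refl,
      rule adele_rel_eqI, (intro adele_rep_intros; assumption), simp add: distrib_right)
  show "(0 :: adele) \<noteq> 1"
    by transfer (simp add: adele_rel_def)
qed

end

text \<open>The diagonal embedding of \<open>\<rat>\<close>.\<close>

lift_definition adele_of_rat :: "rat \<Rightarrow> adele" is "\<lambda>q. (of_rat q, \<lambda>_ _. q)"
  by (simp add: adele_rep_const)

lemma adele_of_rat_0: "adele_of_rat 0 = 0"
  by transfer (simp add: adele_rep_const)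

lemma adele_of_rat_1: "adele_of_rat 1 = 1"
  by transfer (simp add: adele_rep_const)

lemma adele_of_rat_add: "adele_of_rat (q + r) = adele_of_rat q + adele_of_rat r"
  by transfer (simp add: adele_rep_const of_rat_add)

lemma adele_of_rat_uminus: "adele_of_rat (- q) = - adele_of_rat q"
  by transfer (simp add: adele_rep_const of_rat_minus)

lemma adele_of_rat_mult: "adele_of_rat (q * r) = adele_of_rat q * adele_of_rat r"
  by transfer (simp add: adele_rep_const of_rat_mult)

section \<open>The standard character\<close>

text \<open>
  \<open>padic_frac p s\<close> is the \<open>p\<close>-adic fractional part of \<open>y = lim s\<close>: the unique
  \<open>r \<in> \<int>[1/p] \<inter> [0, 1)\<close> with \<open>y - r \<in> \<int>\<^sub>p\<close>.
\<close>

definition is_padic_frac :: "nat \<Rightarrow> (nat \<Rightarrow> rat) \<Rightarrow> rat \<Rightarrow> bool" where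
  "is_padic_frac p s r \<longleftrightarrow> 0 \<le> r \<and> r < 1 \<and> (\<exists>n. of_nat p ^ n * r \<in> \<int>) \<and>
     (\<forall>\<^sub>F n in sequentially. padic_norm p (s n - r) \<le> 1)"

definition padic_frac :: "nat \<Rightarrow> (nat \<Rightarrow> rat) \<Rightarrow> rat" where
  "padic_frac p s = (THE r. is_padic_frac p s r)"

lemma padic_norm_p_power_denom:
  assumes l: "prime l" and p: "prime p" and "l \<noteq> p" and r: "of_nat p ^ n * r \<in> \<int>"
  shows "padic_norm l r \<le> 1"
proof -
  obtain a where a: "of_nat p ^ n * r = of_int a" using r by (auto elim: Ints_cases)
  have p0: "(of_nat p :: rat) \<noteq> 0" using p by (simp add: prime_gt_0_nat)
  have "r = of_int a / of_int (int p ^ n)" using a p0 by (simp add: field_simps)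
  moreover have "\<not> int l dvd int p ^ n"
    using assms by (metis int_dvd_int_iff of_nat_power prime_dvd_power primes_dvd_imp_eq)
  ultimately show ?thesis using padic_norm_le_1_iff[OF l] by blast
qed

lemma p_power_denom_Ints:
  assumes p: "prime p" and r: "of_nat p ^ n * r \<in> \<int>" and "padic_norm p r \<le> 1"
  shows "r \<in> \<int>"
  using assms padic_norm_p_power_denom by (intro all_padic_norm_le_1_imp_Ints) metis

lemma p_power_denom_diff:
  assumes "of_nat p ^ n * (r :: rat) \<in> \<int>" "of_nat p ^ m * s \<in> \<int>"
  shows "of_nat p ^ (n + m) * (r - s) \<in> \<int>"
proof -
  have "of_nat p ^ (n + m) * (r - s)
      = of_nat p ^ m * (of_nat p ^ n * r) - of_nat p ^ n * (of_nat p ^ m * s)"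
    by (simp add: power_add algebra_simps)
  also have "\<dots> \<in> \<int>"
    by (intro Ints_diff Ints_mult[OF Ints_power[OF Ints_of_nat] assms(1)]
        Ints_mult[OF Ints_power[OF Ints_of_nat] assms(2)])
  finally show ?thesis .
qed

lemma is_padic_frac_unique:
  assumes p: "prime p" and "is_padic_frac p s r" "is_padic_frac p s t"
  shows "r = t"
proof -
  have "\<forall>\<^sub>F n in sequentially. padic_norm p (s n - r) \<le> 1 \<and> padic_norm p (s n - t) \<le> 1"
    using assms by (auto simp: is_padic_frac_def intro: eventually_conj)
  then obtain n where n: "padic_norm p (s n - r) \<le> 1" "padic_norm p (s n - t) \<le> 1"
    using eventually_happens[of _ sequentially] by auto
  have "padic_norm p (r - t) \<le> 1"
    using padic_norm_ultra_le[OF p, of "r - s n" 1 "s n - t"] n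
    by (simp add: padic_norm_minus_commute[OF p, of r])
  moreover obtain k where "of_nat p ^ k * (r - t) \<in> \<int>"
    using assms p_power_denom_diff unfolding is_padic_frac_def by metis
  ultimately have "r - t \<in> \<int>" using p_power_denom_Ints[OF p] by blast
  then obtain a where a: "r - t = of_int a" by (auto elim: Ints_cases)
  have "- 1 < r - t" "r - t < 1" using assms by (auto simp: is_padic_frac_def)
  hence "a = 0" unfolding a by linarith
  thus ?thesis using a by simp
qed

lemma is_padic_frac_exists:
  assumes p: "prime p" and s: "padic_Cauchy p s"
  shows "\<exists>r. is_padic_frac p s r"
proof -
  obtain N where N: "\<And>m n. m \<ge> N \<Longrightarrow> n \<ge> N \<Longrightarrow> padic_norm p (s m - s n) < 1"
    using s unfolding padic_Cauchy_def by (meson zero_less_one)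
  obtain a b where ab: "s N = of_int a / of_int b" "b > 0"
    by (metis quotient_of_div quotient_of_denom_pos surj_pair)
  have "\<not> is_unit (int p)" using prime_gt_1_nat[OF p] by simp
  then obtain d where d: "b = int p ^ multiplicity (int p) b * d" "\<not> int p dvd d"
    using multiplicity_decompose'[of b "int p"] ab(2) by blast
  define k where "k = multiplicity (int p) b"
  have "coprime d (int p ^ k)"
    using d(2) p by (metis coprime_commute coprime_power_left_iff prime_imp_coprime prime_nat_int_transfer)
  then obtain u v where uv: "d * u + int p ^ k * v = 1"
    by (metis bezout_int coprime_imp_gcd_eq_1 mult.commute)
  define c where "c = (a * u) mod (int p ^ k)"
  define r :: rat where "r = of_int c / of_int (int p ^ k)"
  have pk: "int p ^ k > 0" using p by (simp add: prime_gt_0_nat)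
  have c: "0 \<le> c" "c < int p ^ k" using pk by (auto simp: c_def)
  have "(of_int c :: rat) < of_int (int p ^ k)" using c by (simp only: of_int_less_iff)
  hence r01: "0 \<le> r" "r < 1" using c pk by (auto simp: r_def)
  have rint: "of_nat p ^ k * r \<in> \<int>" using pk by (simp add: r_def)
  have "int p ^ k dvd c - a * u" by (metis c_def mod_eq_dvd_iff mod_mod_trivial)
  then obtain w where w: "c = a * u + int p ^ k * w" by (metis dvdE diff_eq_eq add.commute)
  have "a - c * d = int p ^ k * (a * v - w * d)"
  proof -
    have "a - c * d = a * (d * u + int p ^ k * v) - c * d" by (simp add: uv)
    thus ?thesis by (simp add: w algebra_simps)
  qed
  hence "(of_int (a - c * d) :: rat) = of_int (int p ^ k * (a * v - w * d))" by (simp only:)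
  moreover have "s N - r = of_int (a - c * d) / of_int (int p ^ k * d)"
  proof -
    have b: "(of_int b :: rat) = of_int (int p ^ k) * of_int d" using d(1) by (metis k_def of_int_mult)
    have "(of_int (int p ^ k) :: rat) \<noteq> 0" "(of_int d :: rat) \<noteq> 0"
      using pk d(2) by auto
    thus ?thesis unfolding ab(1) r_def b of_int_mult of_int_diff
      by (simp add: diff_divide_distrib)
  qed
  ultimately have "s N - r = of_int (a * v - w * d) / of_int d"
    using prime_gt_0_nat[OF p] by simp
  hence sN: "padic_norm p (s N - r) \<le> 1" using d(2) padic_norm_le_1_iff[OF p] by blast
  have "padic_norm p (s n - r) \<le> 1" if "n \<ge> N" for n
    using padic_norm_ultra_le[OF p, of "s n - s N" 1 "s N - r"] sN N[of n N] that by simp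
  hence "\<forall>\<^sub>F n in sequentially. padic_norm p (s n - r) \<le> 1"
    by (auto simp: eventually_sequentially)
  thus ?thesis using r01 rint by (auto simp: is_padic_frac_def)
qed

lemma is_padic_frac_padic_frac:
  assumes "prime p" "padic_Cauchy p s"
  shows "is_padic_frac p s (padic_frac p s)"
  unfolding padic_frac_def using is_padic_frac_exists[OF assms] is_padic_frac_unique[OF assms(1)]
  by (metis theI)

lemma is_padic_frac_cong:
  assumes p: "prime p" and st: "padic_null p (\<lambda>n. s n - t n)" and s: "is_padic_frac p s r"
  shows "is_padic_frac p t r"
proof -
  have "\<forall>\<^sub>F n in sequentially. padic_norm p (s n - t n) < 1"
    using st unfolding padic_null_def by (rule order_tendstoD(2)) simp
  moreover have "\<forall>\<^sub>F n in sequentially. padic_norm p (s n - r) \<le> 1"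
    using s by (simp add: is_padic_frac_def)
  ultimately have "\<forall>\<^sub>F n in sequentially. padic_norm p (t n - r) \<le> 1"
  proof eventually_elim
    case (elim n)
    thus ?case using padic_norm_ultra_le[OF p, of "t n - s n" 1 "s n - r"]
      by (simp add: padic_norm_minus_commute[OF p, of "t n"])
  qed
  thus ?thesis using s by (simp add: is_padic_frac_def)
qed

lift_definition adele_real :: "adele \<Rightarrow> real" is fst
  by (simp add: adele_rel_def)

lift_definition adele_frac :: "nat \<Rightarrow> adele \<Rightarrow> rat" is
  "\<lambda>p a. if prime p then padic_frac p (snd a p) else 0"
proof -
  fix p a b assume ab: "adele_rel a b"
  have "padic_frac p (snd a p) = padic_frac p (snd b p)" if p: "prime p"
  proof -
    have C: "padic_Cauchy p (snd a p)" "padic_Cauchy p (snd b p)"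
      and n: "padic_null p (\<lambda>n. snd a p n - snd b p n)"
      using ab p by (auto simp: adele_rel_def adele_rep_def)
    have "is_padic_frac p (snd b p) (padic_frac p (snd a p))"
      using is_padic_frac_cong[OF p n is_padic_frac_padic_frac[OF p C(1)]] .
    thus ?thesis using is_padic_frac_unique[OF p _ is_padic_frac_padic_frac[OF p C(2)]] by blast
  qed
  thus "(if prime p then padic_frac p (snd a p) else 0) =
        (if prime p then padic_frac p (snd b p) else 0)" by simp
qed

text \<open>
  With \<open>e(t) = exp (2 \<pi> i t)\<close> and \<open>{y}\<^sub>p\<close> the \<open>p\<close>-adic fractional part, this is
  \<open>x \<mapsto> e(x\<^sub>\<infinity>) \<Prod>\<^sub>p e(- {x\<^sub>p}\<^sub>p)\<close>, a product with finitely many nontrivial factors.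
  The opposite signs make it trivial on \<open>\<rat>\<close>.
\<close>

definition adele_char :: "adele \<Rightarrow> complex" where
  "adele_char x = cis (2 * pi *
     (adele_real x - (\<Sum>p | prime p \<and> adele_frac p x \<noteq> 0. of_rat (adele_frac p x))))"

lemma finite_adele_frac: "finite {p. prime p \<and> adele_frac p x \<noteq> 0}"
proof transfer
  fix a assume "adele_rel a a"
  hence a: "adele_rep a" by simp
  have "padic_frac p (snd a p) = 0"
    if p: "prime p" and "\<forall>\<^sub>F n in sequentially. padic_norm p (snd a p n) \<le> 1" for p
  proof -
    have "is_padic_frac p (snd a p) 0" using that by (simp add: is_padic_frac_def)
    thus ?thesis using is_padic_frac_padic_frac[OF p] is_padic_frac_unique[OF p] a p
      unfolding adele_rep_def by blast
  qed
  hence "{p. prime p \<and> (if prime p then padic_frac p (snd a p) else 0) \<noteq> 0}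
     \<subseteq> {p. prime p \<and> \<not> (\<forall>\<^sub>F n in sequentially. padic_norm p (snd a p n) \<le> 1)}"
    by auto
  thus "finite {p. prime p \<and> (if prime p then padic_frac p (snd a p) else 0) \<noteq> 0}"
    using a finite_subset unfolding adele_rep_def by blast
qed

lemma adele_char_eq:
  assumes "finite S" "{p. prime p \<and> adele_frac p x \<noteq> 0} \<subseteq> S" "\<And>p. p \<in> S \<Longrightarrow> prime p"
  shows "adele_char x = cis (2 * pi * (adele_real x - (\<Sum>p\<in>S. of_rat (adele_frac p x))))"
proof -
  have "(\<Sum>p | prime p \<and> adele_frac p x \<noteq> 0. real_of_rat (adele_frac p x))
      = (\<Sum>p\<in>S. of_rat (adele_frac p x))"
    using assms by (intro sum.mono_neutral_left) auto
  thus ?thesis by (simp add: adele_char_def)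
qed

lemma adele_frac_add:
  assumes p: "prime p"
  shows "adele_frac p (x + y) - (adele_frac p x + adele_frac p y) \<in> \<int>"
proof (transfer fixing: p)
  fix a b assume "adele_rel a a" "adele_rel b b"
  hence ab: "adele_rep a" "adele_rep b" by auto
  let ?s = "snd a p" and ?t = "snd b p"
  let ?u = "\<lambda>n. ?s n + ?t n"
  have C: "padic_Cauchy p ?s" "padic_Cauchy p ?t" "padic_Cauchy p ?u"
    using ab p by (auto simp: adele_rep_def padic_Cauchy_add)
  note F = C[THEN is_padic_frac_padic_frac[OF p]]
  let ?d = "padic_frac p ?u - (padic_frac p ?s + padic_frac p ?t)"
  have "\<forall>\<^sub>F n in sequentially. padic_norm p (?s n - padic_frac p ?s) \<le> 1"
    and "\<forall>\<^sub>F n in sequentially. padic_norm p (?t n - padic_frac p ?t) \<le> 1"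
    and "\<forall>\<^sub>F n in sequentially. padic_norm p (?u n - padic_frac p ?u) \<le> 1"
    using F by (auto simp: is_padic_frac_def)
  hence "\<forall>\<^sub>F n in sequentially. padic_norm p ?d \<le> 1"
  proof eventually_elim
    case (elim n)
    have "padic_norm p ((?s n - padic_frac p ?s) + (?t n - padic_frac p ?t)) \<le> 1"
      using elim by (intro padic_norm_ultra_le[OF p])
    hence "padic_norm p ((?s n - padic_frac p ?s) + (?t n - padic_frac p ?t)
        + (padic_frac p ?u - ?u n)) \<le> 1"
      using elim padic_norm_minus_commute[OF p]
      by (intro padic_norm_ultra_le[OF p]) auto
    thus ?case by (simp add: algebra_simps)
  qed
  hence 1: "padic_norm p ?d \<le> 1" by simp
  obtain i j k where ijk: "of_nat p ^ i * padic_frac p ?u \<in> \<int>"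
    "of_nat p ^ j * padic_frac p ?s \<in> \<int>" "of_nat p ^ k * padic_frac p ?t \<in> \<int>"
    using F unfolding is_padic_frac_def by blast
  have "of_nat p ^ (i + j + k) * (padic_frac p ?u - padic_frac p ?s - padic_frac p ?t) \<in> \<int>"
    using ijk by (intro p_power_denom_diff)
  hence "of_nat p ^ (i + j + k) * ?d \<in> \<int>" by (simp add: algebra_simps)
  hence "?d \<in> \<int>" using p_power_denom_Ints[OF p] 1 by blast
  thus "(if prime p then padic_frac p (snd (fst a + fst b, \<lambda>p n. snd a p n + snd b p n) p) else 0) -
      ((if prime p then padic_frac p (snd a p) else 0) +
       (if prime p then padic_frac p (snd b p) else 0)) \<in> \<int>"
    using p by simp
qed

lemma cis_2pi_rat_int: "z \<in> \<int> \<Longrightarrow> cis (2 * pi * real_of_rat z) = 1"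
  by (auto elim!: Ints_cases simp: cis_multiple_2pi)

lemma adele_real_add: "adele_real (x + y) = adele_real x + adele_real y"
  by transfer simp

lemma adele_char_add: "adele_char (x + y) = adele_char x * adele_char y"
proof -
  define S where "S = {p. prime p \<and> adele_frac p x \<noteq> 0} \<union> {p. prime p \<and> adele_frac p y \<noteq> 0}
    \<union> {p. prime p \<and> adele_frac p (x + y) \<noteq> 0}"
  have S: "finite S" "\<And>p. p \<in> S \<Longrightarrow> prime p"
    unfolding S_def using finite_adele_frac by (simp, blast)
  let ?z = "(\<Sum>p\<in>S. adele_frac p x + adele_frac p y - adele_frac p (x + y))"
  have "?z \<in> \<int>"
  proof (rule Ints_sum)
    fix p assume "p \<in> S"
    from Ints_minus[OF adele_frac_add[OF S(2)[OF this], of x y]]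
    show "adele_frac p x + adele_frac p y - adele_frac p (x + y) \<in> \<int>" by simp
  qed
  hence z: "cis (2 * pi * real_of_rat ?z) = 1" by (rule cis_2pi_rat_int)
  let ?f = "\<lambda>z. \<Sum>p\<in>S. real_of_rat (adele_frac p z)"
  have ch: "adele_char z = cis (2 * pi * (adele_real z - ?f z))" if "z \<in> {x, y, x + y}" for z
    using that by (intro adele_char_eq[OF S(1) _ S(2)]) (auto simp: S_def)
  have algebra: "2 * pi * (u + v - c) = 2 * pi * (u - a) + 2 * pi * (v - b) + 2 * pi * (a + b - c)"
    for u v c a b
    by (simp add: algebra_simps)
  have fz: "real_of_rat ?z = ?f x + ?f y - ?f (x + y)"
    by (simp add: of_rat_sum of_rat_add of_rat_diff sum.distrib sum_subtractf)
  have "adele_char (x + y) = cis (2 * pi * (adele_real x + adele_real y - ?f (x + y)))"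
    using ch[of "x + y"] by (simp add: adele_real_add)
  also have "2 * pi * (adele_real x + adele_real y - ?f (x + y)) =
      2 * pi * (adele_real x - ?f x) + 2 * pi * (adele_real y - ?f y) + 2 * pi * real_of_rat ?z"
    unfolding fz
    using algebra[of "adele_real x" "adele_real y" "?f (x + y)" "?f x" "?f y"] .
  also have "cis \<dots> = adele_char x * adele_char y * cis (2 * pi * real_of_rat ?z)"
    by (simp only: ch[of x] ch[of y] insert_iff simp_thms cis_mult)
  finally show ?thesis using z by simp
qed

lemma adele_char_of_rat: "adele_char (adele_of_rat q) = 1"
proof -
  let ?x = "adele_of_rat q"
  let ?S = "{p. prime p \<and> adele_frac p ?x \<noteq> 0}"
  have fr: "padic_norm p (q - adele_frac p ?x) \<le> 1 \<and> (\<exists>n. of_nat p ^ n * adele_frac p ?x \<in> \<int>)"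
    if p: "prime p" for p
  proof -
    have "adele_frac p ?x = padic_frac p (\<lambda>_. q)" using p by transfer simp
    thus ?thesis using is_padic_frac_padic_frac[OF p, of "\<lambda>_. q"] by (simp add: is_padic_frac_def)
  qed
  have "q - (\<Sum>p\<in>?S. adele_frac p ?x) \<in> \<int>"
  proof (rule all_padic_norm_le_1_imp_Ints)
    fix l :: nat assume l: "prime l"
    have other: "padic_norm l (\<Sum>p\<in>?S - {l}. - adele_frac p ?x) \<le> 1"
    proof (rule padic_norm_sum_le_1[OF l])
      fix p assume p: "p \<in> ?S - {l}"
      then obtain n where "of_nat p ^ n * adele_frac p ?x \<in> \<int>" using fr by blast
      hence "padic_norm l (adele_frac p ?x) \<le> 1"
        using p by (intro padic_norm_p_power_denom[OF l]) auto
      thus "padic_norm l (- adele_frac p ?x) \<le> 1" by (simp add: l)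
    qed
    have "(\<Sum>p\<in>?S. adele_frac p ?x) = adele_frac l ?x + (\<Sum>p\<in>?S - {l}. adele_frac p ?x)"
      using finite_adele_frac[of ?x] l
      by (cases "l \<in> ?S") (auto simp: sum.remove)
    hence "q - (\<Sum>p\<in>?S. adele_frac p ?x)
        = (q - adele_frac l ?x) + (\<Sum>p\<in>?S - {l}. - adele_frac p ?x)"
      by (simp add: sum_negf)
    thus "padic_norm l (q - (\<Sum>p\<in>?S. adele_frac p ?x)) \<le> 1"
      using padic_norm_ultra_le[OF l conjunct1[OF fr[OF l]] other] by (simp only:)
  qed
  hence "cis (2 * pi * real_of_rat (q - (\<Sum>p\<in>?S. adele_frac p ?x))) = 1" by (rule cis_2pi_rat_int)
  moreover have "adele_real ?x = of_rat q" by transfer simp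
  ultimately show ?thesis by (simp add: adele_char_def of_rat_diff of_rat_sum)
qed

section \<open>The quotient of the adeles by the rationals\<close>

lemma adele_of_rat_0_in_range [simp]: "0 \<in> range adele_of_rat"
  using rangeI[of adele_of_rat 0] by (simp add: adele_of_rat_0)

quotient_type adele_class = adele / "\<lambda>x y. x - y \<in> range adele_of_rat"
proof (rule equivpI)
  show "reflp (\<lambda>x y. x - y \<in> range adele_of_rat)"
    by (rule reflpI) (simp add: adele_of_rat_0_in_range)
  show "symp (\<lambda>x y. x - y \<in> range adele_of_rat)"
  proof (rule sympI)
    fix x y assume "x - y \<in> range adele_of_rat"
    then obtain q where "x - y = adele_of_rat q" by blast
    hence "y - x = adele_of_rat (- q)" by (simp add: adele_of_rat_uminus flip: minus_diff_eq[of x])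
    thus "y - x \<in> range adele_of_rat" by blast
  qed
  show "transp (\<lambda>x y. x - y \<in> range adele_of_rat)"
  proof (rule transpI)
    fix x y z assume "x - y \<in> range adele_of_rat" "y - z \<in> range adele_of_rat"
    then obtain q r where "x - y = adele_of_rat q" "y - z = adele_of_rat r" by blast
    hence "x - z = adele_of_rat (q + r)" by (simp add: adele_of_rat_add algebra_simps)
    thus "x - z \<in> range adele_of_rat" by blast
  qed
qed

instantiation adele_class :: ab_group_add
begin

lift_definition zero_adele_class :: adele_class is 0 .

lift_definition plus_adele_class :: "adele_class \<Rightarrow> adele_class \<Rightarrow> adele_class" is "(+)"
proof -
  fix x x' y y' assume "x - x' \<in> range adele_of_rat" "y - y' \<in> range adele_of_rat"
  then obtain q r where "x - x' = adele_of_rat q" "y - y' = adele_of_rat r" by blast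
  hence "x + y - (x' + y') = adele_of_rat (q + r)" by (simp add: adele_of_rat_add algebra_simps)
  thus "x + y - (x' + y') \<in> range adele_of_rat" by blast
qed

lift_definition uminus_adele_class :: "adele_class \<Rightarrow> adele_class" is uminus
proof -
  fix x y assume "x - y \<in> range adele_of_rat"
  then obtain q where "x - y = adele_of_rat q" by blast
  hence "- x - - y = adele_of_rat (- q)" by (simp add: adele_of_rat_uminus flip: minus_diff_eq[of x])
  thus "- x - - y \<in> range adele_of_rat" by blast
qed

definition minus_adele_class :: "adele_class \<Rightarrow> adele_class \<Rightarrow> adele_class" where
  "minus_adele_class x y = x + - y"

instance
proof
  fix x y z :: adele_class
  show "x + y + z = x + (y + z)" by transfer (simp add: add.assoc)
  show "x + y = y + x" by transfer (simp add: add.commute)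
  show "0 + x = x" by transfer simp
  show "- x + x = 0" by transfer simp
  show "x - y = x + - y" by (simp add: minus_adele_class_def)
qed

end

lift_definition scaleQ :: "rat \<Rightarrow> adele_class \<Rightarrow> adele_class" (infixr \<open>*\<^sub>Q\<close> 75) is
  "\<lambda>q x. adele_of_rat q * x"
proof -
  fix q x y assume "x - y \<in> range adele_of_rat"
  then obtain r where "x - y = adele_of_rat r" by blast
  hence "adele_of_rat q * x - adele_of_rat q * y = adele_of_rat (q * r)"
    by (simp add: adele_of_rat_mult flip: right_diff_distrib)
  thus "adele_of_rat q * x - adele_of_rat q * y \<in> range adele_of_rat" by blast
qed

interpretation adele_class: vector_space scaleQ
proof
  fix q r :: rat and x y :: adele_class
  show "q *\<^sub>Q (x + y) = q *\<^sub>Q x + q *\<^sub>Q y" by transfer (simp add: distrib_left)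
  show "(q + r) *\<^sub>Q x = q *\<^sub>Q x + r *\<^sub>Q x"
    by transfer (simp add: distrib_right adele_of_rat_add)
  show "q *\<^sub>Q (r *\<^sub>Q x) = (q * r) *\<^sub>Q x"
    by transfer (simp add: adele_of_rat_mult mult.assoc)
  show "1 *\<^sub>Q x = x" by transfer (simp add: adele_of_rat_1)
qed

lift_definition e_Q :: "adele_class \<Rightarrow> complex" is adele_char
proof -
  fix x y assume "x - y \<in> range adele_of_rat"
  then obtain r where "x - y = adele_of_rat r" by blast
  hence "x = adele_of_rat r + y" by (simp add: algebra_simps)
  thus "adele_char x = adele_char y" by (simp add: adele_char_add adele_char_of_rat)
qed

lemma e_Q_add: "e_Q (x + y) = e_Q x * e_Q y"
  by transfer (rule adele_char_add)

lemma norm_e_Q [simp]: "norm (e_Q x) = 1"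
  by transfer (simp add: adele_char_def)

definition circle_group :: "complex monoid" where
  "circle_group = \<lparr>carrier = {c. norm c = 1}, monoid.mult = (*), one = 1\<rparr>"

definition adele_class_group :: "adele_class monoid" where
  "adele_class_group = \<lparr>carrier = UNIV, monoid.mult = (+), one = 0\<rparr>"

text \<open>Elements are functions on \<open>{1..k}\<close>, extended by \<open>undefined\<close>.\<close>

definition adele_class_power :: "nat \<Rightarrow> (nat \<Rightarrow> adele_class) monoid" where
  "adele_class_power k = product_group {1..k} (\<lambda>_. adele_class_group)"

section \<open>Ergodic \<open>\<rat>\<close>-systems\<close>

locale Q_system = prob_space M
  for M :: "'x::metric_space measure" and T :: "rat \<Rightarrow> 'x \<Rightarrow> 'x" +
  assumes compact_space: "compact (UNIV :: 'x set)"
    and sets_eq_borel: "sets M = sets borel"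
    and act_zero: "T 0 x = x"
    and act_add: "T (q + r) x = T q (T r x)"
    and act_homeomorphism: "homeomorphism UNIV UNIV (T q) (T (- q))"
    and act_invariant: "distr M M (T q) = M"

locale ergodic_Q_system = Q_system M T
  for M :: "'x::metric_space measure" and T :: "rat \<Rightarrow> 'x \<Rightarrow> 'x" +
  assumes ergodic: "A \<in> sets M \<Longrightarrow> (\<And>q. T q -` A = A) \<Longrightarrow> measure M A = 0 \<or> measure M A = 1"

section \<open>Phase polynomials\<close>

text \<open>
  Elements of \<open>L\<^sup>\<infinity>\<close> are classes of functions modulo almost everywhere equality;
  operations on classes are defined through representatives.
\<close>

definition Linf :: "'x measure \<Rightarrow> ('x \<Rightarrow> complex) set" where
  "Linf M = {g \<in> borel_measurable M. \<exists>C. AE x in M. norm (g x) \<le> C}"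

definition ae_eq :: "'x measure \<Rightarrow> (('x \<Rightarrow> complex) \<times> ('x \<Rightarrow> complex)) set" where
  "ae_eq M = {(f, g). f \<in> Linf M \<and> g \<in> Linf M \<and> (AE x in M. f x = g x)}"

definition Linf_class :: "'x measure \<Rightarrow> ('x \<Rightarrow> complex) \<Rightarrow> ('x \<Rightarrow> complex) set" where
  "Linf_class M f = ae_eq M `` {f}"

definition mult_deriv :: "(rat \<Rightarrow> 'x \<Rightarrow> 'x) \<Rightarrow> rat \<Rightarrow> ('x \<Rightarrow> complex) \<Rightarrow> 'x \<Rightarrow> complex" where
  "mult_deriv T q g = (\<lambda>x. cnj (g x) * g (T q x))"

definition mult_derivs :: "(rat \<Rightarrow> 'x \<Rightarrow> 'x) \<Rightarrow> rat list \<Rightarrow> ('x \<Rightarrow> complex) \<Rightarrow> 'x \<Rightarrow> complex" where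
  "mult_derivs T qs g = foldl (\<lambda>h q. mult_deriv T q h) g qs"

definition phase_poly ::
    "'x measure \<Rightarrow> (rat \<Rightarrow> 'x \<Rightarrow> 'x) \<Rightarrow> nat \<Rightarrow> ('x \<Rightarrow> complex) \<Rightarrow> bool" where
  "phase_poly M T k g \<longleftrightarrow> g \<in> Linf M \<and>
     (\<forall>qs. length qs = k + 1 \<longrightarrow> (AE x in M. mult_derivs T qs g x = 1))"

definition phase_poly_group ::
    "'x measure \<Rightarrow> (rat \<Rightarrow> 'x \<Rightarrow> 'x) \<Rightarrow> nat \<Rightarrow> ('x \<Rightarrow> complex) set monoid" where
  "phase_poly_group M T k =
     \<lparr>carrier = Linf_class M ` {g. phase_poly M T k g},
      monoid.mult = (\<lambda>F G. \<Union>f\<in>F. \<Union>g\<in>G. Linf_class M (\<lambda>x. f x * g x)),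
      one = Linf_class M (\<lambda>_. 1)\<rparr>"

definition class_deriv ::
    "'x measure \<Rightarrow> (rat \<Rightarrow> 'x \<Rightarrow> 'x) \<Rightarrow> rat \<Rightarrow> ('x \<Rightarrow> complex) set \<Rightarrow> ('x \<Rightarrow> complex) set" where
  "class_deriv M T q F = (\<Union>f\<in>F. Linf_class M (mult_deriv T q f))"

lemma equiv_ae_eq: "equiv (Linf M) (ae_eq M)"
proof (rule equivI)
  show "refl_on (Linf M) (ae_eq M)" by (auto simp: refl_on_def ae_eq_def)
  show "sym (ae_eq M)" by (auto simp: sym_def ae_eq_def elim: AE_mp)
  show "trans (ae_eq M)" by (rule transI) (auto simp: ae_eq_def)
  show "ae_eq M \<subseteq> Linf M \<times> Linf M" by (auto simp: ae_eq_def)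
qed

lemma Linf_class_eq_iff:
  "f \<in> Linf M \<Longrightarrow> g \<in> Linf M \<Longrightarrow> Linf_class M f = Linf_class M g \<longleftrightarrow> (AE x in M. f x = g x)"
  using eq_equiv_class_iff[OF equiv_ae_eq] by (auto simp: Linf_class_def ae_eq_def)

lemma Linf_mult:
  assumes "f \<in> Linf M" "g \<in> Linf M" shows "(\<lambda>x. f x * g x) \<in> Linf M"
proof -
  obtain C D where "AE x in M. norm (f x) \<le> C" "AE x in M. norm (g x) \<le> D"
    using assms by (auto simp: Linf_def)
  hence "AE x in M. norm (f x * g x) \<le> \<bar>C\<bar> * \<bar>D\<bar>"
    by eventually_elim (auto simp: norm_mult intro!: mult_mono)
  thus ?thesis using assms by (auto simp: Linf_def)
qed

lemma mult_Linf_class: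
  assumes f: "f \<in> Linf M" and g: "g \<in> Linf M"
  shows "Linf_class M f \<otimes>\<^bsub>phase_poly_group M T k\<^esub> Linf_class M g = Linf_class M (\<lambda>x. f x * g x)"
proof -
  have eq: "Linf_class M (\<lambda>x. f' x * g' x) = Linf_class M (\<lambda>x. f x * g x)"
    if "f' \<in> Linf_class M f" "g' \<in> Linf_class M g" for f' g'
  proof -
    have m: "f' \<in> Linf M" "g' \<in> Linf M" and "AE x in M. f x = f' x" "AE x in M. g x = g' x"
      using that by (auto simp: Linf_class_def ae_eq_def)
    hence "AE x in M. f' x * g' x = f x * g x" by auto
    thus ?thesis using Linf_class_eq_iff Linf_mult f g m by blast
  qed
  have ne: "f \<in> Linf_class M f" "g \<in> Linf_class M g"
    using f g by (auto simp: Linf_class_def ae_eq_def)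
  have "(\<Union>f'\<in>Linf_class M f. \<Union>g'\<in>Linf_class M g. Linf_class M (\<lambda>x. f' x * g' x))
      = (\<Union>f'\<in>Linf_class M f. \<Union>g'\<in>Linf_class M g. Linf_class M (\<lambda>x. f x * g x))"
    using eq by (simp cong: SUP_cong)
  also have "\<dots> = Linf_class M (\<lambda>x. f x * g x)" using ne by blast
  finally show ?thesis by (simp add: phase_poly_group_def)
qed

context Q_system
begin

lemma measurable_act: "T q \<in> measurable M M"
proof -
  have "continuous_on UNIV (T q)" using act_homeomorphism[of q] by (simp add: homeomorphism_def)
  hence "T q \<in> borel_measurable borel" by (rule borel_measurable_continuous_onI)
  thus ?thesis using measurable_cong_sets[OF sets_eq_borel sets_eq_borel] by blast
qed

lemma AE_act: "(AE x in M. P x) \<Longrightarrow> AE x in M. P (T q x)"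
  using AE_distrD[OF measurable_act[of q], of P] unfolding act_invariant .

lemma Linf_mult_deriv:
  assumes f: "f \<in> Linf M" shows "mult_deriv T q f \<in> Linf M"
proof -
  obtain C where C: "AE x in M. norm (f x) \<le> C" using f by (auto simp: Linf_def)
  have "cnj \<in> borel_measurable borel"
    by (intro borel_measurable_continuous_onI continuous_intros)
  hence "(\<lambda>x. cnj (f x)) \<in> borel_measurable M"
    using f measurable_compose by (force simp: Linf_def)
  hence "(\<lambda>x. cnj (f x)) \<in> Linf M" using f by (simp add: Linf_def)
  moreover have "(\<lambda>x. f (T q x)) \<in> Linf M"
    using f AE_act[OF C, of q] measurable_compose[OF measurable_act, of f borel q]
    unfolding Linf_def by blast
  ultimately show ?thesis unfolding mult_deriv_def by (rule Linf_mult)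
qed

lemma class_deriv_Linf_class:
  assumes f: "f \<in> Linf M"
  shows "class_deriv M T q (Linf_class M f) = Linf_class M (mult_deriv T q f)"
proof -
  have eq: "Linf_class M (mult_deriv T q f') = Linf_class M (mult_deriv T q f)"
    if "f' \<in> Linf_class M f" for f'
  proof -
    have m: "f' \<in> Linf M" and e: "AE x in M. f x = f' x"
      using that by (auto simp: Linf_class_def ae_eq_def)
    have "AE x in M. mult_deriv T q f' x = mult_deriv T q f x"
      using e AE_act[OF e, of q] by eventually_elim (simp add: mult_deriv_def)
    thus ?thesis using Linf_class_eq_iff Linf_mult_deriv f m by blast
  qed
  have ne: "f \<in> Linf_class M f" using f by (auto simp: Linf_class_def ae_eq_def)
  have "class_deriv M T q (Linf_class M f)
      = (\<Union>f'\<in>Linf_class M f. Linf_class M (mult_deriv T q f))"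
    unfolding class_deriv_def using eq by (simp cong: SUP_cong)
  also have "\<dots> = Linf_class M (mult_deriv T q f)" using ne by blast
  finally show ?thesis .
qed

end

end

theory Submission
  imports Defs "HOL-Library.Real_Mod" "HOL-Computational_Algebra.Formal_Power_Series"
begin

text \<open>
  Since \<open>S\<^sup>1\<close> is divisible, there is a character \<open>\<rho>\<close> of the group of circle-valued measurable
  functions that maps every a.e. constant function to its constant. For a phase polynomial \<open>f\<close> of
  degree at most \<open>k\<close> the function \<open>P\<^sub>f(q) = \<rho>(T\<^sup>q f)\<close> is then a polynomial map \<open>\<rat> \<rightarrow> S\<^sup>1\<close> of degree
  at most \<open>k\<close>, and the duality between \<open>\<rat>\<close> and \<open>\<A>/\<rat>\<close> writes it uniquely as
  \<open>P\<^sub>f(q) = \<rho>(f) e\<^sub>Q(\<Sum>\<^sub>j (q choose j) t\<^sub>j)\<close>. The map \<open>f \<mapsto> (\<rho>(f), t\<^sub>1, \<dots>, t\<^sub>k)\<close> is a homomorphism,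
  Vandermonde's identity gives its behaviour under \<open>\<Delta>\<^sub>q\<close>, and if \<open>P\<^sub>f = 1\<close>, then by induction on the
  degree all \<open>\<Delta>\<^sub>q f\<close> are \<open>1\<close>, so \<open>f\<close> is constant by ergodicity and equal to \<open>\<rho>(f) = 1\<close>.
\<close>

section \<open>Duality between the rationals and the adele classes\<close>

text \<open>Evaluation at a point is not defined on almost everywhere classes: each identity has its
  own null set, and representatives would have to be chosen compatibly with products. A character
  \<rho> that sends every function equal to 1 almost everywhere to 1 avoids this. It needs no
  invariance under \<open>T\<close>: multiplicativity alone turns \<Delta>_r f into the difference
  of P_f with step r. The coefficients t_j live in the adele classes because the rational numbers (q
  choose j) must act on them; the circle has no such scalars. The constant term stays in the circle,
  because \<open>e_Q\<close> is not injective: a point t is determined only by all values of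
  \<open>e_Q\<close> on its rational multiples. Over the integers a polynomial map is recovered from
  its value at 0 and its difference with step 1. Over the rationals that difference leaves a
  1-periodic factor undetermined, and divisibility of the rationals is what forces this factor to be
  a character up to a constant.\<close>

lemma cis_2pi_eq_1_iff: "cis (2 * pi * t) = 1 \<longleftrightarrow> t \<in> \<int>"
proof
  assume "cis (2 * pi * t) = 1"
  then obtain n :: int where "2 * pi * t = of_int n * (2 * pi)"
    by (auto simp: cis_eq_1_iff)
  hence "t = of_int n" by simp
  thus "t \<in> \<int>" by simp
qed (auto elim!: Ints_cases simp: cis_multiple_2pi)

section \<open>Integral adeles and separation of points\<close>

lemma adele_frac_abs_eq_0_iff:
  assumes "adele_rep a" "prime p"
  shows "adele_frac p (abs_adele a) = 0 \<longleftrightarrow> (\<forall>\<^sub>F n in sequentially. padic_norm p (snd a p n) \<le> 1)"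
proof -
  have C: "padic_Cauchy p (snd a p)" using assms by (simp add: adele_rep_def)
  have *: "adele_frac p (abs_adele a) = padic_frac p (snd a p)"
    using assms by (simp add: adele_frac.abs_eq)
  show ?thesis
    unfolding * using is_padic_frac_padic_frac[OF assms(2) C] is_padic_frac_unique[OF assms(2), of "snd a p" _ 0]
    by (auto simp: is_padic_frac_def)
qed

lemma adele_char_integral:
  assumes "adele_rep a"
    and "\<And>p. prime p \<Longrightarrow> \<forall>\<^sub>F n in sequentially. padic_norm p (snd a p n) \<le> 1"
  shows "adele_char (abs_adele a) = cis (2 * pi * fst a)"
proof -
  have "{p. prime p \<and> adele_frac p (abs_adele a) \<noteq> 0} = {}"
    using adele_frac_abs_eq_0_iff[OF assms(1)] assms(2) by auto
  thus ?thesis using assms(1) by (simp only: adele_char_def) (simp add: adele_real.abs_eq)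
qed

lemma adele_abs_cases:
  obtains a where "adele_rep a" "x = abs_adele a"
  using Quotient3_abs_rep[OF Quotient3_adele, of x] Quotient3_rep_reflp[OF Quotient3_adele, of x]
  by (metis adele_rel_refl)

lemma adele_of_rat_mult_abs:
  assumes "adele_rep a"
  shows "adele_of_rat q * abs_adele a = abs_adele (of_rat q * fst a, \<lambda>p n. q * snd a p n)"
    and "adele_rep (of_rat q * fst a, \<lambda>p n. q * snd a p n)"
  using assms adele_rep_const[of "of_rat q" q] adele_rep_mult[OF adele_rep_const[of "of_rat q" q] assms]
  by (simp_all add: adele_of_rat_def times_adele.abs_eq)

lemma adele_diff_of_rat_abs:
  assumes "adele_rep a"
  shows "abs_adele a - adele_of_rat q = abs_adele (fst a - of_rat q, \<lambda>p n. snd a p n - q)"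
    and "adele_rep (fst a - of_rat q, \<lambda>p n. snd a p n - q)"
proof -
  have *: "abs_adele a - adele_of_rat q = abs_adele a + adele_of_rat (- q)"
    by (simp add: adele_of_rat_uminus)
  show "abs_adele a - adele_of_rat q = abs_adele (fst a - of_rat q, \<lambda>p n. snd a p n - q)"
    and "adele_rep (fst a - of_rat q, \<lambda>p n. snd a p n - q)"
    unfolding * using assms adele_rep_const[of "of_rat (-q)" "-q"]
      adele_rep_add[OF assms adele_rep_const[of "of_rat (-q)" "-q"]]
    by (simp_all add: adele_of_rat_def plus_adele.abs_eq of_rat_minus)
qed

lemma adele_frac_denom: "prime p \<Longrightarrow> \<exists>n. of_nat p ^ n * adele_frac p x \<in> \<int>"
  and adele_frac_bounds: "0 \<le> adele_frac p x \<and> adele_frac p x < 1"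
proof -
  obtain a where a: "adele_rep a" "x = abs_adele a" by (rule adele_abs_cases)
  have *: "adele_frac p x = padic_frac p (snd a p)" "padic_Cauchy p (snd a p)" if "prime p"
    using a that by (simp_all add: adele_frac.abs_eq adele_rep_def)
  show "\<exists>n. of_nat p ^ n * adele_frac p x \<in> \<int>" if "prime p"
    using is_padic_frac_padic_frac[OF that *(2)[OF that]] *(1)[OF that] by (simp add: is_padic_frac_def)
  show "0 \<le> adele_frac p x \<and> adele_frac p x < 1"
  proof (cases "prime p")
    case True
    thus ?thesis using is_padic_frac_padic_frac[OF True *(2)[OF True]] *(1)[OF True] by (simp add: is_padic_frac_def)
  next
    case False
    thus ?thesis using a by (simp add: adele_frac.abs_eq)
  qed
qed

text \<open>Subtract the sum of all p-adic fractional parts of \<open>x\<close>. At a prime l the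
  parts belonging to other primes are l-integral, so only the part at l matters there, and it
  removes exactly the non-integral portion.\<close>

lemma adele_eq_rat_plus_integral:
  obtains q a where "adele_rep a" "x - adele_of_rat q = abs_adele a"
    "\<And>p. prime p \<Longrightarrow> \<forall>\<^sub>F n in sequentially. padic_norm p (snd a p n) \<le> 1"
proof -
  obtain b where b: "adele_rep b" "x = abs_adele b" by (rule adele_abs_cases)
  let ?S = "{p. prime p \<and> adele_frac p x \<noteq> 0}"
  define q where "q = (\<Sum>p\<in>?S. adele_frac p x)"
  have int: "\<forall>\<^sub>F n in sequentially. padic_norm l (snd b l n - q) \<le> 1" if l: "prime l" for l
  proof -
    have C: "padic_Cauchy l (snd b l)" using b l by (simp add: adele_rep_def)
    have "adele_frac l x = padic_frac l (snd b l)"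
      using b l by (simp add: adele_frac.abs_eq)
    hence ev: "\<forall>\<^sub>F n in sequentially. padic_norm l (snd b l n - adele_frac l x) \<le> 1"
      using is_padic_frac_padic_frac[OF l C] by (simp add: is_padic_frac_def)
    have other: "padic_norm l (\<Sum>p\<in>?S - {l}. - adele_frac p x) \<le> 1"
    proof (rule padic_norm_sum_le_1[OF l])
      fix p assume p: "p \<in> ?S - {l}"
      then obtain n where "of_nat p ^ n * adele_frac p x \<in> \<int>" using adele_frac_denom by blast
      hence "padic_norm l (adele_frac p x) \<le> 1"
        using p by (intro padic_norm_p_power_denom[OF l]) auto
      thus "padic_norm l (- adele_frac p x) \<le> 1" by (simp add: l)
    qed
    have q: "q = adele_frac l x + (\<Sum>p\<in>?S - {l}. adele_frac p x)"
      unfolding q_def using finite_adele_frac[of x] l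
      by (cases "l \<in> ?S") (auto simp: sum.remove)
    show ?thesis using ev
    proof eventually_elim
      case (elim n)
      have "snd b l n - q = (snd b l n - adele_frac l x) + (\<Sum>p\<in>?S - {l}. - adele_frac p x)"
        by (simp add: sum_negf q)
      thus ?case using padic_norm_ultra_le[OF l elim other] by (simp only:)
    qed
  qed
  show ?thesis
    by (rule that[OF adele_diff_of_rat_abs(2)[OF b(1), of q]])
       (use int b adele_diff_of_rat_abs(1)[OF b(1)] in auto)
qed

lemma e_Q_abs: "e_Q (q *\<^sub>Q abs_adele_class x) = adele_char (adele_of_rat q * x)"
  by (simp add: scaleQ.abs_eq e_Q.abs_eq)

text \<open>Modulo the rationals \<open>t\<close> has an integral representative. Testing with q = 1
  makes its real coordinate an integer, and subtracting this integer leaves an integral adele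
  \<open>d\<close> with real coordinate 0. Testing with 1 / p^n isolates the prime p, since this
  number is l-integral for every other prime l, and puts the p-coordinate of \<open>d\<close> into
  p^n Z_p. As n is arbitrary, \<open>d\<close> vanishes.\<close>

lemma e_Q_separates:
  assumes "\<And>q. e_Q (q *\<^sub>Q t) = 1"
  shows "t = 0"
proof -
  obtain x where t: "t = abs_adele_class x"
    by (metis Quotient3_abs_rep[OF Quotient3_adele_class])
  obtain q a where a: "adele_rep a" "x - adele_of_rat q = abs_adele a"
    and ai: "\<And>p. prime p \<Longrightarrow> \<forall>\<^sub>F n in sequentially. padic_norm p (snd a p n) \<le> 1"
    using adele_eq_rat_plus_integral[of x] by metis
  have ch: "adele_char (adele_of_rat r * abs_adele a) = 1" for r
  proof -
    have "adele_char (adele_of_rat r * x) = 1" using assms[of r] by (simp add: t e_Q_abs)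
    moreover have "adele_of_rat r * x = adele_of_rat r * abs_adele a + adele_of_rat (r * q)"
      unfolding a(2)[symmetric] by (simp add: algebra_simps adele_of_rat_mult)
    ultimately show ?thesis by (simp add: adele_char_add adele_char_of_rat)
  qed
  have "cis (2 * pi * fst a) = 1"
    using ch[of 1] adele_char_integral[OF a(1) ai] by (simp add: adele_of_rat_1)
  then obtain m where m: "fst a = of_int m" by (auto simp: cis_2pi_eq_1_iff elim: Ints_cases)
  define d where "d = (0 :: real, \<lambda>p n. snd a p n - of_int m)"
  have d: "adele_rep d" "abs_adele a - adele_of_rat (of_int m) = abs_adele d"
    using adele_diff_of_rat_abs[OF a(1), of "of_int m"] m by (simp_all add: d_def)
  have di: "\<forall>\<^sub>F n in sequentially. padic_norm p (snd d p n) \<le> 1" if p: "prime p" for p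
    using ai[OF p]
  proof eventually_elim
    case (elim n)
    thus ?case using padic_norm_ultra_le[OF p elim, of "- of_int m"] padic_norm_of_int[OF p, of m] p
      by (simp add: d_def)
  qed
  have chd: "adele_char (adele_of_rat r * abs_adele d) = 1" for r
  proof -
    have "adele_of_rat r * abs_adele a = adele_of_rat r * abs_adele d + adele_of_rat (r * of_int m)"
      unfolding d(2)[symmetric] by (simp add: algebra_simps adele_of_rat_mult)
    thus ?thesis using ch[of r] by (simp add: adele_char_add adele_char_of_rat)
  qed
  have small: "\<forall>\<^sub>F i in sequentially. padic_norm p (snd d p i) \<le> (1 / real p) ^ n"
    if p: "prime p" for p n
  proof -
    define r :: rat where "r = 1 / of_nat p ^ n"
    have p0: "(of_nat p :: rat) \<noteq> 0" "real p > 0" using p by (simp_all add: prime_gt_0_nat)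
    define w where "w = adele_of_rat r * abs_adele d"
    note w = adele_of_rat_mult_abs[OF d(1), of r, folded w_def]
    have "adele_frac l w = 0" if l: "prime l" "l \<noteq> p" for l
    proof -
      have "of_nat p ^ n * r \<in> \<int>" using p0 by (simp add: r_def)
      hence rl: "padic_norm l r \<le> 1" using padic_norm_p_power_denom[OF l(1) p l(2)] by blast
      have "\<forall>\<^sub>F i in sequentially. padic_norm l (r * snd d l i) \<le> 1" using di[OF l(1)]
        by eventually_elim (simp add: padic_norm_mult[OF l(1)] rl mult_le_one)
      thus ?thesis using adele_frac_abs_eq_0_iff[OF w(2) l(1)] w(1) by simp
    qed
    \<comment> \<open>Only the prime \<open>p\<close> contributes and the real coordinate is 0, so
      the character is trivial only if the fractional part at \<open>p\<close> is an integer; lying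
      in [0, 1), it is then 0.\<close>
    hence "adele_char w = cis (2 * pi * (adele_real w - (\<Sum>p\<in>{p}. of_rat (adele_frac p w))))"
      using p by (intro adele_char_eq) auto
    moreover have "adele_real w = 0"
      using w by (simp add: adele_real.abs_eq d_def)
    ultimately have "real_of_rat (adele_frac p w) \<in> \<int>"
      using chd[of r] cis_2pi_eq_1_iff[of "- real_of_rat (adele_frac p w)"] by (simp add: w_def)
    then obtain z where z: "real_of_rat (adele_frac p w) = real_of_int z" by (auto elim: Ints_cases)
    hence "adele_frac p w = of_int z" by (metis of_rat_eq_iff of_rat_of_int_eq)
    hence "adele_frac p w = 0" using adele_frac_bounds[of p w] by simp
    hence "\<forall>\<^sub>F i in sequentially. padic_norm p (r * snd d p i) \<le> 1"
      using adele_frac_abs_eq_0_iff[OF w(2) p] w(1) by simp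
    moreover have "padic_norm p r = real p ^ n"
    proof -
      have "\<not> is_unit (int p)" "int p \<noteq> 0" using prime_gt_1_nat[OF p] by auto
      hence "multiplicity (int p) (int p ^ n) = n" by (simp add: multiplicity_same_power)
      moreover have "multiplicity (int p) 1 = 0" by simp
      ultimately show ?thesis
        using padic_norm_frac[OF p, of 1 "int p ^ n"] p0 by (simp add: r_def)
    qed
    ultimately show ?thesis
      by (elim eventually_mono) (use p0 in \<open>simp add: padic_norm_mult[OF p] field_simps\<close>)
  qed
  have "padic_null p (snd d p)" if p: "prime p" for p
    unfolding padic_null_def
  proof (rule order_tendstoI)
    fix e :: real assume "e < 0"
    thus "\<forall>\<^sub>F n in sequentially. e < padic_norm p (snd d p n)"
      using padic_norm_nonneg less_le_trans by (intro always_eventually allI) blast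
  next
    fix e :: real assume e: "0 < e"
    obtain n where "(1 / real p) ^ n < e"
      using real_arch_pow_inv[OF e, of "1 / real p"] prime_gt_1_nat[OF p] by auto
    thus "\<forall>\<^sub>F n in sequentially. padic_norm p (snd d p n) < e"
      using small[OF p, of n] by (elim eventually_mono) linarith
  qed
  hence "adele_rel d (0, \<lambda>_ _. 0)"
    using d(1) adele_rep_const by (simp add: adele_rel_def d_def)
  hence "abs_adele d = 0"
    unfolding zero_adele_def by (metis Quotient3_rel_abs[OF Quotient3_adele])
  hence "x = adele_of_rat (q + of_int m)"
    using d(2) a(2) by (simp add: adele_of_rat_add algebra_simps)
  hence "abs_adele_class x = abs_adele_class 0"
    by (simp add: adele_class.abs_eq_iff)
  thus ?thesis by (simp add: t zero_adele_class_def)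
qed

section \<open>Characters of the rationals\<close>

text \<open>Factorials serve as denominators because they form a chain under divisibility: a
  character is then determined by the single sequence of its values at 1 / N!, with one
  compatibility condition per step.\<close>

lemma rat_eq_of_int_div_fact: "\<exists>m n. q = of_int m / fact n" for q :: rat
proof -
  obtain a b where q: "q = of_int a / of_int b" "b > 0"
    by (metis quotient_of_div quotient_of_denom_pos surj_pair)
  have "b = int (nat b)" "1 \<le> nat b" using q(2) by auto
  hence "nat b dvd fact (nat b)" by (intro dvd_fact) auto
  then obtain c where c: "fact (nat b) = nat b * c" by (auto elim: dvdE)
  have f: "(fact (nat b) :: rat) = of_int b * of_nat c"
    using q(2) by (metis \<open>b = int (nat b)\<close> c of_int_of_nat_eq of_nat_fact of_nat_mult)
  have "(of_nat c :: rat) \<noteq> 0" using f by (metis fact_nonzero mult_zero_right)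
  hence "q = of_int (a * int c) / fact (nat b)" unfolding f using q by simp
  thus ?thesis by blast
qed

lemma padic_norm_le_of_power_dvd:
  assumes p: "prime p" and "int p ^ n dvd a"
  shows "padic_norm p (of_int a) \<le> (1 / real p) ^ n"
proof (cases "a = 0")
  case False
  have "n \<le> multiplicity (int p) a"
    using assms False prime_gt_1_nat[OF p] by (intro multiplicity_geI) auto
  moreover have "padic_norm p (of_int a) = (1 / real p) ^ multiplicity (int p) a"
    using padic_norm_frac[OF p False, of 1] by (simp add: power_int_minus power_one_over inverse_eq_divide)
  ultimately show ?thesis using prime_gt_1_nat[OF p] by (simp add: power_decreasing)
qed simp

text \<open>Since a! b! divides (a + b)!, the power (p!)^n divides (p n)!. Thus a congruence modulo
  (p n)! is in particular one modulo p^n.\<close>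

lemma power_dvd_fact_mult: "p ^ n dvd (fact (p * n) :: nat)" if "p > 0"
proof -
  have "fact p ^ n dvd (fact (p * n) :: nat)"
  proof (induction n)
    case (Suc n)
    have "fact p * fact (p * n) dvd (fact (p + p * n) :: nat)" by (rule fact_fact_dvd_fact)
    moreover have "fact p * fact p ^ n dvd (fact p * fact (p * n) :: nat)" using Suc by (intro mult_dvd_mono) auto
    ultimately show ?case by (auto intro: dvd_trans)
  qed simp
  moreover have "p ^ n dvd (fact p ^ n :: nat)" using that by (intro dvd_power_same dvd_fact) auto
  ultimately show ?thesis by (rule dvd_trans[rotated])
qed

text \<open>For the bound p^(-n) the index \<open>p * n\<close> suffices: from there on all terms
  agree modulo (p n)!, hence modulo p^n.\<close>

lemma padic_Cauchy_fact:
  fixes a :: "nat \<Rightarrow> int"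
  assumes p: "prime p" and a: "\<And>N M. N \<le> M \<Longrightarrow> fact N dvd a M - a N"
  shows "padic_Cauchy p (\<lambda>n. of_int (a n))"
  unfolding padic_Cauchy_def
proof (intro allI impI)
  fix e :: real assume e: "0 < e"
  obtain n where n: "(1 / real p) ^ n < e"
    using real_arch_pow_inv[OF e, of "1 / real p"] prime_gt_1_nat[OF p] by auto
  have "padic_norm p (of_int (a m) - of_int (a l)) < e" if "m \<ge> p * n" "l \<ge> p * n" for m l
  proof -
    have "int (p ^ n) dvd int (fact (p * n))"
      using power_dvd_fact_mult[OF prime_gt_0_nat[OF p]] by (simp only: int_dvd_int_iff)
    hence "int p ^ n dvd fact (p * n)" by simp
    moreover have "fact (p * n) dvd (a m - a (p * n)) - (a l - a (p * n))"
      using that by (intro dvd_diff a)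
    ultimately have "int p ^ n dvd a m - a l" by (auto intro: dvd_trans)
    from padic_norm_le_of_power_dvd[OF p this] n show ?thesis by simp
  qed
  thus "\<exists>N. \<forall>m\<ge>N. \<forall>l\<ge>N. padic_norm p (of_int (a m) - of_int (a l)) < e" by blast
qed

lemma character_power:
  fixes \<psi> :: "rat \<Rightarrow> complex"
  assumes "\<And>q. norm (\<psi> q) = 1" "\<And>q r. \<psi> (q + r) = \<psi> q * \<psi> r"
  shows "\<psi> 0 = 1" "\<psi> (of_nat n * q) = \<psi> q ^ n" "\<psi> (of_int m * q) = \<psi> q powi m"
proof -
  have "\<psi> 0 \<noteq> 0" using assms(1)[of 0] by auto
  thus 0: "\<psi> 0 = 1" using assms(2)[of 0 0] by simp
  show n: "\<psi> (of_nat n * q) = \<psi> q ^ n" for n q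
    by (induction n) (simp_all add: 0 assms(2) distrib_right)
  have i: "\<psi> (- q) = inverse (\<psi> q)" for q
    using assms(2)[of q "- q"] 0 by (metis add.right_inverse inverse_unique)
  show "\<psi> (of_int m * q) = \<psi> q powi m"
  proof (cases "m \<ge> 0")
    case True
    thus ?thesis using n[of "nat m" q] by (simp add: power_int_def)
  next
    case False
    hence "(of_int m :: rat) * q = - (of_nat (nat (- m)) * q)" by simp
    hence "\<psi> (of_int m * q) = inverse (\<psi> q ^ nat (- m))" by (simp only: i n)
    thus ?thesis using False by (simp add: power_int_def power_inverse)
  qed
qed

lemma characters_eqI:
  fixes \<psi> \<rho> :: "rat \<Rightarrow> complex"
  assumes "\<And>q. norm (\<psi> q) = 1" "\<And>q r. \<psi> (q + r) = \<psi> q * \<psi> r"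
    and "\<And>q. norm (\<rho> q) = 1" "\<And>q r. \<rho> (q + r) = \<rho> q * \<rho> r"
    and "\<And>n. \<psi> (1 / fact n) = \<rho> (1 / fact n)"
  shows "\<psi> q = \<rho> q"
proof -
  obtain m n where q: "q = of_int m / fact n" using rat_eq_of_int_div_fact by blast
  hence "q = of_int m * (1 / fact n)" by simp
  thus ?thesis
    using character_power(3)[of \<psi>, OF assms(1,2)] character_power(3)[of \<rho>, OF assms(3,4)] assms(5)
    by metis
qed

lemma unimodular_eq_cis:
  assumes "norm (z :: complex) = 1" obtains t where "z = cis (2 * pi * t)"
proof -
  have "z = cis (2 * pi * (Arg z / (2 * pi)))"
    using rcis_cmod_Arg[of z] assms by (simp add: rcis_def)
  thus ?thesis by (rule that)
qed

text \<open>
  Writing \<open>\<psi> (1 / N!) = e((\<theta> + a\<^sub>N) / N!)\<close> with integers \<open>a\<^sub>N\<close>, one has \<open>a\<^sub>M \<equiv> a\<^sub>N (mod N!)\<close> for \<open>N \<le> M\<close>, so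
  \<open>a\<close> converges in every \<open>\<int>\<^sub>p\<close>, and \<open>x = (\<theta>, -lim a, -lim a, \<dots>)\<close> represents \<open>\<psi>\<close>.
\<close>

lemma rat_character_eq_e_Q:
  fixes \<psi> :: "rat \<Rightarrow> complex"
  assumes norm: "\<And>q. norm (\<psi> q) = 1" and add: "\<And>q r. \<psi> (q + r) = \<psi> q * \<psi> r"
  obtains x where "\<And>q. \<psi> q = e_Q (q *\<^sub>Q x)"
proof -
  note pw = character_power[of \<psi>, OF norm add]
  obtain \<theta> where \<theta>: "\<psi> 1 = cis (2 * pi * \<theta>)" using unimodular_eq_cis[OF norm] by blast
  \<comment> \<open>An angle t of \<open>\<psi> (1 / fact N)\<close> is a real number with N! t
    congruent to \<theta> modulo 1.\<close>
  have ex: "\<exists>a :: int. \<psi> (1 / fact N) = cis (2 * pi * ((\<theta> + of_int a) / fact N))" for N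
  proof -
    obtain t where t: "\<psi> (1 / fact N) = cis (2 * pi * t)" using unimodular_eq_cis[OF norm] by blast
    have "\<psi> 1 = \<psi> (1 / fact N) ^ fact N"
      using pw(2)[of "fact N" "1 / fact N"] by simp
    hence "cis (2 * pi * \<theta>) = cis (2 * pi * (fact N * t))"
      by (simp only: \<theta> t Complex.DeMoivre of_nat_fact mult.left_commute)
    hence "cis (2 * pi * (fact N * t - \<theta>)) = 1"
      by (simp add: right_diff_distrib flip: cis_divide)
    then obtain a where "fact N * t - \<theta> = of_int a" unfolding cis_2pi_eq_1_iff by (auto elim: Ints_cases)
    hence "t = (\<theta> + of_int a) / fact N" by (simp add: field_simps)
    thus ?thesis using t by blast
  qed
  then obtain a :: "nat \<Rightarrow> int"
    where a: "\<And>N. \<psi> (1 / fact N) = cis (2 * pi * ((\<theta> + of_int (a N)) / fact N))" by metis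
  have step: "fact N dvd a (Suc N) - a N" for N
  proof -
    have "(of_nat (Suc N) * (1 / fact (Suc N)) :: rat) = 1 / fact N"
      by (simp del: of_nat_Suc)
    hence "\<psi> (1 / fact N) = \<psi> (1 / fact (Suc N)) ^ Suc N"
      using pw(2)[of "Suc N" "1 / fact (Suc N)"] by (simp only:)
    also have "\<dots> = cis (real (Suc N) * (2 * pi * ((\<theta> + of_int (a (Suc N))) / fact (Suc N))))"
      by (simp only: a Complex.DeMoivre)
    also have "real (Suc N) * (2 * pi * ((\<theta> + of_int (a (Suc N))) / fact (Suc N)))
        = 2 * pi * ((\<theta> + of_int (a (Suc N))) / fact N)"
      by (simp del: of_nat_Suc)
    finally have "cis (2 * pi * ((\<theta> + of_int (a (Suc N))) / fact N - (\<theta> + of_int (a N)) / fact N)) = 1"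
      by (simp add: right_diff_distrib a flip: cis_divide)
    then obtain z where "(\<theta> + of_int (a (Suc N))) / fact N - (\<theta> + of_int (a N)) / fact N = of_int z"
      unfolding cis_2pi_eq_1_iff by (auto elim: Ints_cases)
    hence "real_of_int (a (Suc N) - a N) = of_int (fact N * z)"
      unfolding diff_divide_distrib[symmetric] by (simp add: divide_eq_eq mult.commute)
    hence "a (Suc N) - a N = fact N * z" by (simp only: of_int_eq_iff)
    thus ?thesis by simp
  qed
  have dvd: "fact N dvd a M - a N" if "N \<le> M" for N M
    using that
  proof (induction rule: dec_induct)
    case (step n)
    have "fact N dvd (fact n :: int)" using step by (intro fact_dvd) auto
    hence "fact N dvd a (Suc n) - a n" using \<open>\<And>N. fact N dvd a (Suc N) - a N\<close>[of n] by (rule dvd_trans)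
    from dvd_add[OF this step.IH] show ?case by simp
  qed simp
  \<comment> \<open>One integer sequence serves all primes. Its terms have p-adic norm at most 1, so
    the condition of the restricted product holds with no exceptional prime.\<close>
  define b where "b = (\<theta>, \<lambda>(p::nat) n. of_int (- a n) :: rat)"
  have bint: "padic_norm p (of_int (- a n)) \<le> 1" if "prime p" for p n
    using padic_norm_of_int[OF that] .
  have "padic_Cauchy p (\<lambda>n. of_int (- a n))" if "prime p" for p
    using padic_Cauchy_uminus[OF that padic_Cauchy_fact[OF that dvd]] by simp
  hence b: "adele_rep b"
    using bint by (simp add: adele_rep_def b_def cong: conj_cong)
  define x where "x = abs_adele_class (abs_adele b)"
  have gen: "\<psi> (1 / fact N) = e_Q ((1 / fact N) *\<^sub>Q x)" for N
  proof -
    \<comment> \<open>Translating by the rational number \<open>- a N\<close> does not affect the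
      character, even after division by N!, and makes the finite coordinates eventually divisible by
      N!. The quotient is an integral adele, on which the character sees only the real coordinate.
      This is also why \<open>a\<close> enters \<open>b\<close> with a minus sign.\<close>
    define c where "c = (\<theta> + of_int (a N), \<lambda>(p::nat) n. of_int (a N - a n) :: rat)"
    have c: "adele_rep c" "abs_adele b - adele_of_rat (- of_int (a N)) = abs_adele c"
      using adele_diff_of_rat_abs[OF b, of "- of_int (a N)"]
      by (simp_all add: b_def c_def of_rat_minus)
    define d where "d = (of_rat (1 / fact N) * fst c, \<lambda>p n. (1 / fact N) * snd c p n)"
    have d: "adele_rep d" "adele_of_rat (1 / fact N) * abs_adele c = abs_adele d"
      using adele_of_rat_mult_abs[OF c(1), of "1 / fact N"] by (simp_all add: d_def)
    have "\<forall>\<^sub>F n in sequentially. padic_norm p (snd d p n) \<le> 1" if p: "prime p" for p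
      using eventually_ge_at_top[of N]
    proof eventually_elim
      case (elim n)
      then obtain z where "a n - a N = fact N * z" using dvd[OF elim] by (auto elim: dvdE)
      hence "(of_int (a n - a N) :: rat) = of_int (fact N * z)" by (simp only:)
      hence "snd d p n = of_int (- z)" by (simp add: d_def c_def field_simps)
      thus ?case using padic_norm_of_int[OF p] by (simp only:)
    qed
    hence "adele_char (abs_adele d) = cis (2 * pi * fst d)"
      by (intro adele_char_integral d)
    moreover have "real_of_rat (fact N) = fact N" by (metis of_nat_fact of_rat_of_nat_eq)
    hence "fst d = (\<theta> + of_int (a N)) / fact N" by (simp add: d_def c_def of_rat_divide)
    ultimately have 1: "adele_char (abs_adele d) = \<psi> (1 / fact N)" by (simp add: a)
    have "adele_of_rat (1 / fact N) * abs_adele b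
        = abs_adele d + adele_of_rat ((1 / fact N) * - of_int (a N))"
      unfolding d(2)[symmetric] c(2)[symmetric] adele_of_rat_mult by (simp add: algebra_simps)
    hence "e_Q ((1 / fact N) *\<^sub>Q x) = adele_char (abs_adele d)"
      by (simp add: x_def e_Q_abs adele_char_add adele_char_of_rat)
    thus ?thesis using 1 by simp
  qed
  have "\<psi> q = e_Q (q *\<^sub>Q x)" for q
    by (rule characters_eqI[of \<psi> "\<lambda>q. e_Q (q *\<^sub>Q x)", OF norm add])
       (simp_all add: gen adele_class.scale_left_distrib e_Q_add)
  thus ?thesis by (rule that)
qed

section \<open>Polynomial maps from the rationals to the circle\<close>

lemma cnj_mult_self_unimodular: "norm z = 1 \<Longrightarrow> cnj z * z = 1" for z :: complex
  by (simp add: complex_norm_square[symmetric] mult.commute)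

definition rat_character :: "(rat \<Rightarrow> complex) \<Rightarrow> bool" where
  "rat_character \<psi> \<longleftrightarrow> (\<forall>q. norm (\<psi> q) = 1) \<and> (\<forall>q r. \<psi> (q + r) = \<psi> q * \<psi> r)"

text \<open>\<open>poly_map n\<close> are the polynomial maps of degree less than \<open>n\<close>.\<close>

primrec poly_map :: "nat \<Rightarrow> (rat \<Rightarrow> complex) \<Rightarrow> bool" where
  "poly_map 0 P \<longleftrightarrow> (\<forall>q. P q = 1)"
| "poly_map (Suc n) P \<longleftrightarrow> (\<forall>q. norm (P q) = 1) \<and> (\<forall>r. poly_map n (\<lambda>q. cnj (P q) * P (q + r)))"

lemma poly_map_norm: "poly_map n P \<Longrightarrow> norm (P q) = 1"
  by (cases n) auto

lemma poly_map_mult: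
  "poly_map n P \<Longrightarrow> poly_map n Q \<Longrightarrow> poly_map n (\<lambda>q. P q * Q q)"
proof (induction n arbitrary: P Q)
  case (Suc n)
  have "poly_map n (\<lambda>q. (cnj (P q) * P (q + r)) * (cnj (Q q) * Q (q + r)))" for r
    using Suc.prems by (intro Suc.IH[of "\<lambda>q. cnj (P q) * P (q + r)"]) auto
  thus ?case using Suc.prems by (simp add: norm_mult mult_ac)
qed simp

lemma poly_map_cnj: "poly_map n P \<Longrightarrow> poly_map n (\<lambda>q. cnj (P q))"
proof (induction n arbitrary: P)
  case (Suc n)
  have "poly_map n (\<lambda>q. cnj (cnj (P q) * P (q + r)))" for r
    using Suc.prems by (intro Suc.IH) auto
  thus ?case using Suc.prems by simp
qed simp

section \<open>Binomial sums with coefficients in the adele classes\<close>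

text \<open>The sum starts at 1 because the constant term is kept as a factor in the circle.\<close>

definition binom_sum :: "nat \<Rightarrow> (nat \<Rightarrow> adele_class) \<Rightarrow> rat \<Rightarrow> adele_class" where
  "binom_sum n t q = (\<Sum>j=1..n. (q gchoose j) *\<^sub>Q t j)"

text \<open>These are the \<open>t'\<^sub>i(r)\<close> of the theorem.\<close>

definition binom_shift :: "nat \<Rightarrow> (nat \<Rightarrow> adele_class) \<Rightarrow> rat \<Rightarrow> nat \<Rightarrow> adele_class" where
  "binom_shift n t r i = (\<Sum>j=i+1..n. (r gchoose (j - i)) *\<^sub>Q t j)"

lemma binom_sum_0 [simp]: "binom_sum 0 t q = 0" "binom_sum n t 0 = 0"
  by (auto simp: binom_sum_def gbinomial_0_left intro!: sum.neutral)

lemma binom_sum_add: "binom_sum n (\<lambda>j. s j + t j) q = binom_sum n s q + binom_sum n t q"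
  by (simp add: binom_sum_def adele_class.scale_right_distrib sum.distrib)

lemma binom_sum_diff: "binom_sum n (\<lambda>j. s j - t j) q = binom_sum n s q - binom_sum n t q"
  by (simp add: binom_sum_def adele_class.scale_right_diff_distrib sum_subtractf)

lemma binom_sum_mono_neutral:
  assumes "m \<le> n" "\<And>j. m < j \<Longrightarrow> t j = 0"
  shows "binom_sum n t q = binom_sum m t q"
  unfolding binom_sum_def using assms by (intro sum.mono_neutral_right) auto

text \<open>In Vandermonde's expansion of \<open>q + r gchoose j\<close> the diagonal i = j
  reproduces \<open>binom_sum n t q\<close>. The triangle i < j, summed over j first, has the
  coefficients \<open>binom_shift\<close>; its row i = 0 does not depend on \<open>q\<close> and is
  split off.\<close>

lemma binom_sum_shift:
  "binom_sum n t (q + r) =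
     binom_sum n t q + (binom_shift n t r 0 + binom_sum (n - 1) (binom_shift n t r) q)"
proof -
  define g where "g i j = (q gchoose i) *\<^sub>Q ((r gchoose (j - i)) *\<^sub>Q t j)" for i j
  have "(q + r gchoose j) *\<^sub>Q t j = (q gchoose j) *\<^sub>Q t j + (\<Sum>i\<in>{0..<j}. g i j)" for j
  proof -
    have "(q + r gchoose j) *\<^sub>Q t j = (\<Sum>i=0..j. g i j)"
      unfolding gbinomial_Vandermonde[symmetric] g_def
      by (simp add: adele_class.scale_sum_left)
    also have "{0..j} = insert j {0..<j}" by auto
    finally show ?thesis by (simp add: g_def)
  qed
  hence "binom_sum n t (q + r) = binom_sum n t q + (\<Sum>j=1..n. \<Sum>i\<in>{0..<j}. g i j)"
    by (simp add: binom_sum_def sum.distrib)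
  also have "(\<Sum>j=1..n. \<Sum>i\<in>{0..<j}. g i j) = (\<Sum>i\<in>{0..<n}. \<Sum>j=i+1..n. g i j)"
    by (subst (1 2) sum.Sigma) (auto intro!: sum.reindex_bij_witness[of _ prod.swap prod.swap])
  also have "\<dots> = (\<Sum>i\<in>{0..<n}. (q gchoose i) *\<^sub>Q binom_shift n t r i)"
    by (simp add: g_def binom_shift_def adele_class.scale_sum_right)
  also have "\<dots> = binom_shift n t r 0 + binom_sum (n - 1) (binom_shift n t r) q"
  proof (cases n)
    case (Suc m)
    have "{0..<n} = insert 0 {1..m}" using Suc by auto
    thus ?thesis by (simp add: binom_sum_def Suc)
  qed (simp add: binom_shift_def)
  finally show ?thesis .
qed

text \<open>Pascal's rule: the index j - i is at least 1, and \<open>1 gchoose m\<close> vanishes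
  for m > 1, so a step of length 1 just shifts the coefficients down by one place.\<close>

lemma binom_shift_1: "binom_shift (Suc n) t 1 i = (if i \<le> n then t (Suc i) else 0)"
proof -
  have 0: "((1::rat) gchoose (j - i)) = (if j = Suc i then 1 else 0)" if "j \<ge> i + 1" for j
  proof (cases "j = Suc i")
    case False
    have "(1::rat) gchoose (j - i) = of_nat (1 choose (j - i))" by (metis binomial_gbinomial of_nat_1)
    thus ?thesis using False that by (simp add: binomial_eq_0)
  qed simp
  have "binom_shift (Suc n) t 1 i = (\<Sum>j=i+1..Suc n. if j = Suc i then t j else 0)"
    unfolding binom_shift_def by (rule sum.cong) (auto simp: 0)
  thus ?thesis by simp
qed

lemma binom_sum_cong: "(\<And>j. 1 \<le> j \<Longrightarrow> j \<le> n \<Longrightarrow> s j = t j) \<Longrightarrow> binom_sum n s q = binom_sum n t q"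
  by (simp add: binom_sum_def)

lemma binom_sum_plus_1:
  "binom_sum (Suc n) t (q + 1) = binom_sum (Suc n) t q + (t 1 + binom_sum n (\<lambda>j. t (Suc j)) q)"
proof -
  have "binom_sum n (binom_shift (Suc n) t 1) q = binom_sum n (\<lambda>j. t (Suc j)) q"
    by (rule binom_sum_cong) (simp add: binom_shift_1)
  thus ?thesis by (simp add: binom_sum_shift[of "Suc n" t q 1] binom_shift_1)
qed

lemma e_Q_0 [simp]: "e_Q 0 = 1"
  using e_Q_add[of 0 0] norm_e_Q[of 0] by (metis add_0 mult_cancel_right1 norm_zero zero_neq_one)

text \<open>A point of the circle is the value at 1 of the character q \<mapsto> e(q t) of the
  rationals, which \<open>e_Q\<close> represents.\<close>

lemma e_Q_surj:
  assumes "norm z = 1" obtains x where "z = e_Q x"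
proof -
  obtain t where t: "z = cis (2 * pi * t)" using unimodular_eq_cis[OF assms] .
  obtain x where "\<And>q. cis (2 * pi * (of_rat q * t)) = e_Q (q *\<^sub>Q x)"
    using rat_character_eq_e_Q[of "\<lambda>q. cis (2 * pi * (of_rat q * t))"]
    by (auto simp: of_rat_add cis_mult algebra_simps)
  from this[of 1] t show ?thesis by (intro that[of x]) simp
qed

lemma poly_map_binom_sum:
  "norm z = 1 \<Longrightarrow> poly_map (Suc n) (\<lambda>q. z * e_Q (binom_sum n t q))"
proof (induction n arbitrary: t z)
  case 0
  thus ?case by (simp add: cnj_mult_self_unimodular)
next
  case (Suc n)
  have "cnj (z * e_Q (binom_sum (Suc n) t q)) * (z * e_Q (binom_sum (Suc n) t (q + r)))
      = e_Q (binom_shift (Suc n) t r 0) * e_Q (binom_sum n (binom_shift (Suc n) t r) q)" for q r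
  proof -
    have "cnj (z * e_Q (binom_sum (Suc n) t q)) * (z * e_Q (binom_sum (Suc n) t q)) = 1"
      using Suc.prems by (intro cnj_mult_self_unimodular) (simp add: norm_mult)
    thus ?thesis by (simp add: binom_sum_shift e_Q_add mult_ac)
  qed
  thus ?case using Suc.IH Suc.prems by (simp add: norm_mult del: poly_map.simps(2) add: poly_map.simps(2)[of "Suc n"])
qed

text \<open>
  The characters \<open>C r = cnj (D r 0) * D r\<close> of the derivatives \<open>D r\<close> are multiplicative in \<open>r\<close>, so
  \<open>C r (a / b) = C (r / b) (a / b) ^ b = C (r / b) a = 1\<close> by periodicity. Hence \<open>Q\<close> has degree one.
\<close>

lemma poly_map_periodic:
  assumes "poly_map n Q" "\<And>q. Q (q + 1) = Q q"
  shows "rat_character (\<lambda>q. cnj (Q 0) * Q q)"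
  using assms
proof (induction n arbitrary: Q)
  case 0
  thus ?case by (simp add: rat_character_def)
next
  case (Suc n)
  define D where "D r q = cnj (Q q) * Q (q + r)" for r q
  have Q1: "norm (Q q) = 1" for q using Suc.prems(1) by simp
  have Qc: "Q q * cnj (Q q) = 1" for q using Q1 cnj_mult_self_unimodular[of "Q q"] by (simp add: mult.commute)
  have D1: "norm (D r q) = 1" for r q by (simp add: D_def norm_mult Q1)
  have Dc: "D r q * cnj (D r q) = 1" for r q
    using D1 cnj_mult_self_unimodular[of "D r q"] by (simp add: mult.commute)
  define C where "C r q = cnj (D r 0) * D r q" for r q
  have C: "rat_character (C r)" for r
    unfolding C_def
  proof (rule Suc.IH)
    have "D r = (\<lambda>q. cnj (Q q) * Q (q + r))" by (simp add: D_def fun_eq_iff)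
    thus "poly_map n (D r)" using Suc.prems(1) by simp
    show "D r (q + 1) = D r q" for q
      using Suc.prems(2)[of q] Suc.prems(2)[of "q + r"] by (simp add: D_def add_ac)
  qed
  have Cn: "norm (C r q) = 1" and Ca: "C r (q + s) = C r q * C r s" for r q s
    using C by (auto simp: rat_character_def)
  note Cpow = character_power[of "C r" for r, OF Cn Ca]
  have C1: "C r 1 = 1" for r
  proof -
    have "D r 1 = D r 0"
      using Suc.prems(2)[of 0] Suc.prems(2)[of r] by (simp add: D_def add_ac)
    thus ?thesis using Dc[of r 0] by (simp add: C_def mult.commute)
  qed
  have DC: "D r q = D r 0 * C r q" for r q
    using Dc[of r 0] by (simp add: C_def mult.assoc[symmetric])
  have Dadd: "D (r + s) q = D r (q + s) * D s q" for r s q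
    using Qc[of "q + s"] by (simp add: D_def add_ac mult_ac)
  \<comment> \<open>Comparing the cocycle identity \<open>Dadd\<close> at \<open>q\<close> and at 0
    cancels the constants; the shift by \<open>s\<close> inside \<open>D r\<close> contributes only
    the factor \<open>C r s\<close>, which occurs on both sides.\<close>
  have Cadd: "C (r + s) q = C r q * C s q" for r s q
  proof -
    have 0: "D (r + s) 0 = D r 0 * C r s * D s 0" using Dadd[of r s 0] DC[of r s] by simp
    have "D (r + s) 0 * C (r + s) q = (D r 0 * C r (q + s)) * (D s 0 * C s q)"
      using Dadd[of r s q] DC by metis
    hence "D (r + s) 0 * C (r + s) q = D (r + s) 0 * (C r q * C s q)"
      by (simp add: 0 Ca mult_ac)
    moreover have "D (r + s) 0 \<noteq> 0" using D1[of "r + s" 0] by auto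
    ultimately show ?thesis by simp
  qed
  have Ctriv: "C r q = 1" for r q
  proof -
    obtain a b where q: "q = of_int a / of_nat b" "b > 0"
      by (metis of_int_of_nat_eq quotient_of_div quotient_of_denom_pos surj_pair zero_less_imp_eq_int of_nat_0_less_iff)
    have "C r q = C (of_nat b * (r / of_nat b)) q" using q(2) by simp
    also have "\<dots> = C (r / of_nat b) q ^ b"
      using character_power(2)[of "\<lambda>r. C r q" b "r / of_nat b"] Cn Cadd by simp
    also have "\<dots> = C (r / of_nat b) (of_nat b * q)" by (rule Cpow(2)[symmetric])
    also have "of_nat b * q = of_int a * 1" using q by simp
    finally show ?thesis unfolding Cpow(3) by (simp add: C1)
  qed
  have "cnj (Q 0) * Q (q + r) = (cnj (Q 0) * Q q) * (cnj (Q 0) * Q r)" for q r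
  proof -
    have "Q (q + r) = Q q * D r q" using Qc[of q] by (simp add: D_def mult.assoc[symmetric])
    also have "D r q = cnj (Q 0) * Q r" using DC[of r q] Ctriv by (simp add: D_def)
    finally show ?thesis by (simp add: mult_ac)
  qed
  thus ?case by (simp add: rat_character_def norm_mult Q1)
qed

text \<open>
  Summing the expansion of \<open>q \<mapsto> P (q + 1) / P q\<close> determines \<open>P\<close> up to a \<open>1\<close>-periodic factor, which is a
  character times a constant and is absorbed in \<open>t 1\<close>.
\<close>

theorem poly_map_eq_binom_sum:
  assumes "poly_map (Suc n) P"
  shows "\<exists>t. \<forall>q. P q = P 0 * e_Q (binom_sum n t q)"
  using assms
proof (induction n arbitrary: P)
  case 0
  have "P q = P 0" for q
  proof -
    have "cnj (P 0) * P (0 + q) = 1" "cnj (P 0) * P 0 = 1"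
      using 0 cnj_mult_self_unimodular[of "P 0"] unfolding poly_map.simps by blast+
    hence "cnj (P 0) * P q = 1" "cnj (P 0) * P 0 = 1" by simp_all
    thus ?thesis by (metis mult_left_cancel mult_zero_left zero_neq_one)
  qed
  thus ?case by simp
next
  case (Suc n)
  have P1: "norm (P q) = 1" for q using Suc.prems by simp
  have Pc: "P q * cnj (P q) = 1" for q using P1 cnj_mult_self_unimodular[of "P q"] by (simp add: mult.commute)
  define D where "D q = cnj (P q) * P (q + 1)" for q
  have "poly_map (Suc n) D" using Suc.prems unfolding D_def by (subst (asm) poly_map.simps(2)) blast
  then obtain s where s: "D q = D 0 * e_Q (binom_sum n s q)" for q using Suc.IH by blast
  have "norm (D 0) = 1" by (simp add: D_def norm_mult P1)
  then obtain s0 where s0: "D 0 = e_Q s0" using e_Q_surj by blast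
  \<comment> \<open>Discrete summation raises each index by one: the constant \<open>e_Q s0\<close>
    of the difference becomes the linear coefficient.\<close>
  define t where "t = (\<lambda>j. if j = 1 then s0 else s (j - 1))"
  define E where "E q = e_Q (binom_sum (Suc n) t q)" for q
  have Ec: "E q * cnj (E q) = 1" for q
    using cnj_mult_self_unimodular[of "E q"] by (simp add: mult.commute E_def)
  have "binom_sum n (\<lambda>j. t (Suc j)) q = binom_sum n s q" for q
    by (rule binom_sum_cong) (simp add: t_def)
  hence E: "E (q + 1) = E q * D q" for q
    using s[of q] by (simp add: E_def binom_sum_plus_1 e_Q_add s0 t_def)
  define Q where "Q q = P q * cnj (E q)" for q
  have "poly_map (Suc (Suc n)) E"
    using poly_map_binom_sum[of 1 "Suc n" t] by (simp add: E_def)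
  hence "poly_map (Suc (Suc n)) Q"
    unfolding Q_def by (intro poly_map_mult Suc.prems poly_map_cnj)
  moreover have "Q (q + 1) = Q q" for q
  proof -
    have "P (q + 1) = P q * D q" using Pc[of q] by (simp add: D_def mult.assoc[symmetric])
    moreover have "D q * cnj (D q) = 1"
      using Pc[of q] Pc[of "q + 1"] by (simp add: D_def mult_ac)
    ultimately show ?thesis by (simp add: Q_def E mult_ac)
  qed
  ultimately have "rat_character (\<lambda>q. cnj (Q 0) * Q q)" by (rule poly_map_periodic)
  then obtain u where u: "cnj (Q 0) * Q q = e_Q (q *\<^sub>Q u)" for q
    using rat_character_eq_e_Q[of "\<lambda>q. cnj (Q 0) * Q q"] unfolding rat_character_def by metis
  have E0: "E 0 = 1" by (simp add: E_def)
  hence Q0: "Q 0 = P 0" by (simp add: Q_def)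
  have "P q = P 0 * e_Q (binom_sum (Suc n) (\<lambda>j. t j + (if j = 1 then u else 0)) q)" for q
  proof -
    have "P q = Q q * E q" using Ec[of q] by (simp add: Q_def mult.assoc mult.commute[of "cnj (E q)"])
    also have "Q q = P 0 * e_Q (q *\<^sub>Q u)"
      using u[of q] Pc[of 0] by (simp add: Q0 flip: mult.assoc u[of q])
    finally have "P q = P 0 * e_Q (q *\<^sub>Q u) * E q" .
    moreover have "binom_sum (Suc n) (\<lambda>j. if j = 1 then u else 0) q = q *\<^sub>Q u"
    proof -
      have "binom_sum (Suc n) (\<lambda>j. if j = 1 then u else 0) q = binom_sum 1 (\<lambda>j. if j = 1 then u else 0) q"
        by (rule binom_sum_mono_neutral) auto
      thus ?thesis by (simp add: binom_sum_def)
    qed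
    ultimately show ?thesis by (simp add: binom_sum_add e_Q_add E_def mult_ac)
  qed
  thus ?case by blast
qed

text \<open>The difference with step 1 shifts the coefficients down, so induction kills all of them
  but the linear one. For that one \<open>e_Q (t 1) = 1\<close> is not enough; triviality of
  \<open>e_Q\<close> on all rational multiples of \<open>t 1\<close> is needed.\<close>

theorem binom_sum_unique:
  assumes "\<And>q. e_Q (binom_sum n t q) = 1" "1 \<le> j" "j \<le> n"
  shows "t j = 0"
  using assms
proof (induction n arbitrary: t j)
  case (Suc n)
  have *: "e_Q (t 1) * e_Q (binom_sum n (\<lambda>j. t (Suc j)) q) = 1" for q
    using Suc.prems(1)[of "q + 1"] Suc.prems(1)[of q] by (simp add: binom_sum_plus_1 e_Q_add)
  have "e_Q (t 1) = 1" using *[of 0] by simp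
  hence "e_Q (binom_sum n (\<lambda>j. t (Suc j)) q) = 1" for q using *[of q] by simp
  hence tS: "t (Suc i) = 0" if "1 \<le> i" "i \<le> n" for i using Suc.IH[of "\<lambda>j. t (Suc j)" i] that by blast
  have "binom_sum (Suc n) t q = q *\<^sub>Q t 1" for q
  proof -
    have "{1..Suc n} = insert 1 {2..Suc n}" by auto
    moreover have "(\<Sum>j=2..Suc n. (q gchoose j) *\<^sub>Q t j) = 0"
    proof (rule sum.neutral, intro ballI)
      fix j assume "j \<in> {2..Suc n}"
      thus "(q gchoose j) *\<^sub>Q t j = 0" using tS[of "j - 1"] by (cases j) auto
    qed
    ultimately show ?thesis by (simp add: binom_sum_def)
  qed
  hence "t 1 = 0" using Suc.prems(1) by (intro e_Q_separates) metis
  thus ?case using tS[of "j - 1"] Suc.prems by (cases "j = 1") auto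
qed simp

section \<open>Extension of circle-valued characters\<close>

lemma comm_group_circle_group: "comm_group circle_group"
proof (rule comm_groupI)
  show "\<exists>y\<in>carrier circle_group. y \<otimes>\<^bsub>circle_group\<^esub> x = \<one>\<^bsub>circle_group\<^esub>"
    if "x \<in> carrier circle_group" for x
    using that by (intro bexI[of _ "inverse x"]) (auto simp: circle_group_def norm_inverse intro!: left_inverse)
qed (auto simp: circle_group_def norm_mult mult_ac)

interpretation circle: comm_group circle_group by (rule comm_group_circle_group)

lemma circle_group_simps [simp]:
  "z \<in> carrier circle_group \<longleftrightarrow> norm z = 1"
  "z \<otimes>\<^bsub>circle_group\<^esub> w = z * w"
  "\<one>\<^bsub>circle_group\<^esub> = 1"
  by (simp_all add: circle_group_def)

text \<open>Divisibility of the circle, which makes characters extendable.\<close>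

lemma unimodular_root:
  assumes "norm (w :: complex) = 1" "n > 0" obtains z where "norm z = 1" "z ^ n = w"
proof -
  have "w = cis (Arg w)" using rcis_cmod_Arg[of w] assms(1) by (simp add: rcis_def)
  hence "cis (Arg w / real n) ^ n = w" using assms(2) by (simp add: Complex.DeMoivre)
  thus ?thesis by (intro that[of "cis (Arg w / real n)"]) auto
qed

text \<open>Characters of subgroups of \<open>G\<close>, represented by their graphs.\<close>

definition partial_character :: "('a, 'b) monoid_scheme \<Rightarrow> ('a \<times> complex) set \<Rightarrow> bool" where
  "partial_character G R \<longleftrightarrow> subgroup R (G \<times>\<times> circle_group) \<and> (\<forall>w. (\<one>\<^bsub>G\<^esub>, w) \<in> R \<longrightarrow> w = 1)"

context comm_group
begin

lemma DirProd_circle: "comm_group (G \<times>\<times> circle_group)"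
  by (rule group.group_comm_groupI[OF DirProd_group[OF is_group circle.is_group]])
     (auto simp: m_comm mult.commute)

text \<open>The quotient of two points of the graph over the same \<open>x\<close> lies over the
  identity.\<close>

lemma partial_character_unique:
  assumes R: "partial_character G R" "(x, w) \<in> R" "(x, z) \<in> R"
  shows "w = z"
proof -
  interpret K: comm_group "G \<times>\<times> circle_group" by (rule DirProd_circle)
  have s: "subgroup R (G \<times>\<times> circle_group)" using R(1) by (simp add: partial_character_def)
  have "R \<subseteq> carrier (G \<times>\<times> circle_group)" using s by (rule subgroup.subset)
  hence c: "x \<in> carrier G" "norm w = 1" "norm z = 1" using R(2,3) by auto
  have "inv\<^bsub>G \<times>\<times> circle_group\<^esub> (x, z) = (inv x, inv\<^bsub>circle_group\<^esub> z)"
    by (rule inv_DirProd) (use c in \<open>auto intro: circle.is_group\<close>)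
  hence "(inv x, inv\<^bsub>circle_group\<^esub> z) \<in> R" using subgroup.m_inv_closed[OF s R(3)] by simp
  from subgroup.m_closed[OF s R(2) this]
  have "(\<one>, w * inv\<^bsub>circle_group\<^esub> z) \<in> R" using c by simp
  hence "w * inv\<^bsub>circle_group\<^esub> z = 1" using R(1) by (simp add: partial_character_def)
  moreover have "inv\<^bsub>circle_group\<^esub> z * z = 1" using circle.l_inv[of z] c by simp
  ultimately show ?thesis by (metis mult.assoc mult.right_neutral mult_1)
qed

text \<open>The new graph is the product of \<open>R\<close> with the cyclic subgroup generated by
  \<open>(x, z)\<close>. It is a subgroup for any unimodular \<open>z\<close>; the choice of
  \<open>z\<close> only has to ensure that its fibre over the identity is trivial, that is, that z^n
  agrees with \<open>R\<close> wherever x^n lies in the domain.\<close>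

lemma partial_character_extend:
  assumes R: "partial_character G R" and x: "x \<in> carrier G"
  obtains R' z where "partial_character G R'" "R \<subseteq> R'" "(x, z) \<in> R'"
proof -
  let ?K = "G \<times>\<times> circle_group"
  interpret K: comm_group ?K by (rule DirProd_circle)
  have s: "subgroup R ?K" and one: "\<And>w. (\<one>, w) \<in> R \<Longrightarrow> w = 1"
    using R by (auto simp: partial_character_def)
  have Rc: "R \<subseteq> carrier ?K" using s by (rule subgroup.subset)
  have pow: "(y, z) [^]\<^bsub>?K\<^esub> (n::nat) = (y [^] n, z ^ n)" for y z n
    by (induction n) (simp_all add: mult.commute)
  \<comment> \<open>\<open>z\<close> must satisfy \<open>z\<^sup>m = R(x\<^sup>m)\<close> for the least \<open>m > 0\<close> with \<open>x\<^sup>m\<close> in the domain, if any.\<close>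
  obtain z where z: "norm z = 1" and zR: "\<And>n w. (x [^] (n::nat), w) \<in> R \<Longrightarrow> w = z ^ n"
  proof (cases "\<exists>n>0. \<exists>w. (x [^] (n::nat), w) \<in> R")
    case False
    have "w = 1 ^ n" if "(x [^] n, w) \<in> R" for n w
      using False that one by (cases "n = 0") (simp, blast)
    thus ?thesis by (intro that[of 1]) auto
  next
    case True
    define m where "m = (LEAST n::nat. n > 0 \<and> (\<exists>w. (x [^] n, w) \<in> R))"
    have m: "m > 0" "\<exists>w. (x [^] m, w) \<in> R"
      using LeastI_ex[OF True] unfolding m_def by blast+
    have least: "m \<le> n" if "n > 0" "(x [^] n, w) \<in> R" for n w
      unfolding m_def using that by (intro Least_le) auto
    obtain v where v: "(x [^] m, v) \<in> R" using m by blast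
    have v1: "norm v = 1" using v Rc by auto
    obtain z where z: "norm z = 1" "z ^ m = v" using unimodular_root[OF v1 m(1)] .
    \<comment> \<open>By minimality an exponent occurring in the domain is 0 or at least
      \<open>m\<close>, and in the latter case subtracting \<open>m\<close> gives another such
      exponent.\<close>
    have "w = z ^ n" if "(x [^] n, w) \<in> R" for n w
      using that
    proof (induction n arbitrary: w rule: less_induct)
      case (less n)
      show ?case
      proof (cases "n = 0")
        case True thus ?thesis using less.prems one by simp
      next
        case False
        hence mn: "m \<le> n" using least less.prems by blast
        have cw: "norm w = 1" using less.prems Rc by auto
        have "inv\<^bsub>?K\<^esub> (x [^] m, v) = (inv (x [^] m), inv\<^bsub>circle_group\<^esub> v)"
          by (rule inv_DirProd) (use x v1 in \<open>auto intro: circle.is_group\<close>)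
        hence "(inv (x [^] m), inv\<^bsub>circle_group\<^esub> v) \<in> R" using subgroup.m_inv_closed[OF s v] by simp
        from subgroup.m_closed[OF s less.prems this]
        have in1: "(x [^] n \<otimes> inv (x [^] m), w * inv\<^bsub>circle_group\<^esub> v) \<in> R" by simp
        have "x [^] n = x [^] (n - m) \<otimes> x [^] m" using mn x by (simp add: nat_pow_mult)
        hence "x [^] n \<otimes> inv (x [^] m) = x [^] (n - m)" using x by (simp add: m_assoc)
        with in1 have "(x [^] (n - m), w * inv\<^bsub>circle_group\<^esub> v) \<in> R" by simp
        hence "w * inv\<^bsub>circle_group\<^esub> v = z ^ (n - m)" using less.IH[of "n - m"] m(1) mn False by auto
        moreover have "inv\<^bsub>circle_group\<^esub> v * v = 1" using circle.l_inv[of v] v1 by simp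
        ultimately have "w = z ^ (n - m) * z ^ m"
          unfolding z(2) by (metis mult.assoc mult.right_neutral)
        thus ?thesis using mn by (simp flip: power_add)
      qed
    qed
    thus ?thesis using z that by blast
  qed
  have k: "(x, z) \<in> carrier ?K" using x z by simp
  define N where "N = generate ?K {(x, z)}"
  have N: "subgroup N ?K" unfolding N_def using k by (intro K.generate_is_subgroup) simp
  have Nmem: "(x, z) \<in> N" unfolding N_def by (rule generate.incl) simp
  define R' where "R' = R <#>\<^bsub>?K\<^esub> N"
  have R': "subgroup R' ?K" unfolding R'_def by (rule K.mult_subgroups[OF s N])
  have "R \<subseteq> R'" unfolding R'_def set_mult_def
  proof
    fix r assume r: "r \<in> R"
    have "r = r \<otimes>\<^bsub>?K\<^esub> \<one>\<^bsub>?K\<^esub>" using r Rc by (auto simp del: mult_DirProd one_DirProd)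
    thus "r \<in> (\<Union>h\<in>R. \<Union>k\<in>N. {h \<otimes>\<^bsub>?K\<^esub> k})" using r subgroup.one_closed[OF N] by blast
  qed
  moreover have "(x, z) \<in> R'" unfolding R'_def set_mult_def
  proof -
    have "(x, z) = \<one>\<^bsub>?K\<^esub> \<otimes>\<^bsub>?K\<^esub> (x, z)" using k by (simp del: mult_DirProd one_DirProd)
    thus "(x, z) \<in> (\<Union>h\<in>R. \<Union>k\<in>N. {h \<otimes>\<^bsub>?K\<^esub> k})" using Nmem subgroup.one_closed[OF s] by blast
  qed
  moreover have "w = 1" if w: "(\<one>, w) \<in> R'" for w
  proof -
    obtain r u where r: "r \<in> R" and u: "u \<in> N" and ru: "(\<one>, w) = r \<otimes>\<^bsub>?K\<^esub> u"
      using w unfolding R'_def set_mult_def by blast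
    \<comment> \<open>\<open>zR\<close> concerns natural exponents only; a negative power of
      \<open>(x, z)\<close> is treated through its inverse.\<close>
    have "\<exists>n::nat. u = (x, z) [^]\<^bsub>?K\<^esub> n \<or> inv\<^bsub>?K\<^esub> u = (x, z) [^]\<^bsub>?K\<^esub> n"
    proof -
      obtain i :: int where i: "u = (x, z) [^]\<^bsub>?K\<^esub> i" using u K.generate_pow[OF k] unfolding N_def by auto
      show ?thesis
      proof (cases "i \<ge> 0")
        case True
        thus ?thesis using i by (metis int_pow_def2 not_less)
      next
        case False
        thus ?thesis using i k by (metis int_pow_def2 not_le K.inv_inv K.nat_pow_closed)
      qed
    qed
    then obtain n :: nat where n: "u = (x, z) [^]\<^bsub>?K\<^esub> n \<or> inv\<^bsub>?K\<^esub> u = (x, z) [^]\<^bsub>?K\<^esub> n" by blast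
    have uc: "u \<in> carrier ?K" using subgroup.subset[OF N] u by blast
    have rc: "r \<in> carrier ?K" using r Rc by blast
    obtain r1 r2 where r12: "r = (r1, r2)" "r1 \<in> carrier G" "norm r2 = 1" using rc by auto
    obtain u1 u2 where u12: "u = (u1, u2)" "u1 \<in> carrier G" "norm u2 = 1" using uc by auto
    have ru1: "r1 \<otimes> u1 = \<one>" and ru2: "w = r2 * u2" using ru by (simp_all add: r12 u12)
    have inv_pair: "inv\<^bsub>?K\<^esub> (y, v) = (inv y, inv\<^bsub>circle_group\<^esub> v)"
      if "y \<in> carrier G" "norm v = 1" for y v
      by (rule inv_DirProd) (use that in \<open>auto intro: circle.is_group\<close>)
    have inv_circle: "v * inv\<^bsub>circle_group\<^esub> v = 1" if "norm v = 1" for v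
      using circle.r_inv[of v] that by simp
    show "w = 1"
    proof (cases "u = (x, z) [^]\<^bsub>?K\<^esub> n")
      case True
      hence u': "u1 = x [^] n" "u2 = z ^ n" by (simp_all add: u12 pow)
      have "(inv r1, inv\<^bsub>circle_group\<^esub> r2) \<in> R"
        using subgroup.m_inv_closed[OF s r] inv_pair r12 by simp
      moreover have "inv r1 = u1" using ru1 r12 u12 by (metis inv_equality m_comm)
      ultimately have "inv\<^bsub>circle_group\<^esub> r2 = u2" using zR u' by simp
      thus ?thesis using inv_circle[of r2] r12 ru2 by simp
    next
      case False
      hence "inv\<^bsub>?K\<^esub> u = (x [^] n, z ^ n)" using n by (simp add: pow)
      hence u': "inv u1 = x [^] n" "inv\<^bsub>circle_group\<^esub> u2 = z ^ n"
        using inv_pair u12 by simp_all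
      have "r1 = inv u1" using ru1 r12 u12 by (metis inv_equality)
      hence "r2 = inv\<^bsub>circle_group\<^esub> u2" using zR[of n r2] r r12 u' by simp
      thus ?thesis using inv_circle[of u2] u12 ru2 by (simp add: mult.commute)
    qed
  qed
  ultimately show ?thesis using R' by (intro that[of R' z]) (auto simp: partial_character_def)
qed

text \<open>Zorn's lemma for graphs ordered by inclusion: unions of chains are again graphs, and a
  maximal graph is total because any missing point could be added by
  \<open>partial_character_extend\<close>.\<close>

theorem circle_character_extend:
  assumes H: "subgroup H G" and \<psi>: "\<psi> \<in> hom (G\<lparr>carrier := H\<rparr>) circle_group"
  obtains \<rho> where "\<rho> \<in> hom G circle_group" "\<And>h. h \<in> H \<Longrightarrow> \<rho> h = \<psi> h"
proof -
  let ?K = "G \<times>\<times> circle_group"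
  interpret K: comm_group ?K by (rule DirProd_circle)
  define R0 where "R0 = (\<lambda>h. (h, \<psi> h)) ` H"
  have \<psi>1: "norm (\<psi> h) = 1" if "h \<in> H" for h using \<psi> that by (auto simp: hom_def)
  have \<psi>m: "\<psi> (g \<otimes> h) = \<psi> g * \<psi> h" if "g \<in> H" "h \<in> H" for g h
    using \<psi> that by (auto simp: hom_def)
  have Hc: "H \<subseteq> carrier G" using H by (rule subgroup.subset)
  have H1: "\<one> \<in> H" using H by (rule subgroup.one_closed)
  have \<psi>one: "\<psi> \<one> = 1" using \<psi>m[OF H1 H1] \<psi>1[OF H1] by auto
  have inv_pair: "inv\<^bsub>?K\<^esub> (h, \<psi> h) = (inv h, \<psi> (inv h))" if h: "h \<in> H" for h
  proof (rule K.inv_equality)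
    have "inv h \<in> H" using H h by (rule subgroup.m_inv_closed)
    thus "(inv h, \<psi> (inv h)) \<otimes>\<^bsub>?K\<^esub> (h, \<psi> h) = \<one>\<^bsub>?K\<^esub>"
      "(h, \<psi> h) \<in> carrier ?K" "(inv h, \<psi> (inv h)) \<in> carrier ?K"
      using h Hc \<psi>1 \<psi>m[of "inv h" h] \<psi>one by auto
  qed
  have R0: "partial_character G R0"
    unfolding partial_character_def
  proof (intro conjI allI impI)
    show "subgroup R0 ?K"
    proof (rule K.subgroupI)
      show "R0 \<subseteq> carrier ?K" using Hc \<psi>1 by (auto simp: R0_def)
      show "R0 \<noteq> {}" using H1 by (auto simp: R0_def)
      show "inv\<^bsub>?K\<^esub> a \<in> R0" if "a \<in> R0" for a
        using that inv_pair subgroup.m_inv_closed[OF H] by (auto simp: R0_def)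
      show "a \<otimes>\<^bsub>?K\<^esub> b \<in> R0" if "a \<in> R0" "b \<in> R0" for a b
        using that subgroup.m_closed[OF H] by (auto simp: R0_def \<psi>m[symmetric])
    qed
    show "w = 1" if "(\<one>, w) \<in> R0" for w using that \<psi>one by (auto simp: R0_def)
  qed
  let ?A = "{R. partial_character G R \<and> R0 \<subseteq> R}"
  have "\<exists>R\<in>?A. \<forall>X\<in>?A. R \<subseteq> X \<longrightarrow> X = R"
  proof (rule subset_Zorn_nonempty)
    show "?A \<noteq> {}" using R0 by blast
    fix \<C> assume ne: "\<C> \<noteq> {}" and ch: "subset.chain ?A \<C>"
    have C: "partial_character G R" "R0 \<subseteq> R" if "R \<in> \<C>" for R
      using ch that unfolding subset.chain_def by auto
    hence Cs: "subgroup R ?K" if "R \<in> \<C>" for R using that by (auto simp: partial_character_def)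
    have "subgroup (\<Union>\<C>) ?K"
    proof (rule K.subgroupI)
      show "\<Union>\<C> \<subseteq> carrier ?K" by (rule Union_least) (rule subgroup.subset[OF Cs])
      show "\<Union>\<C> \<noteq> {}" using ne subgroup.one_closed[OF Cs] by fast
      show "inv\<^bsub>?K\<^esub> a \<in> \<Union>\<C>" if "a \<in> \<Union>\<C>" for a
        using that subgroup.m_inv_closed[OF Cs] by (elim UnionE) (rule UnionI)
      show "a \<otimes>\<^bsub>?K\<^esub> b \<in> \<Union>\<C>" if ab: "a \<in> \<Union>\<C>" "b \<in> \<Union>\<C>" for a b
      proof -
        obtain R S where RS: "R \<in> \<C>" "S \<in> \<C>" "a \<in> R" "b \<in> S" using ab by blast
        hence "R \<subseteq> S \<or> S \<subseteq> R" using ch unfolding subset.chain_def by blast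
        then obtain Q where Q: "Q \<in> \<C>" "a \<in> Q" "b \<in> Q" using RS by blast
        thus ?thesis using subgroup.m_closed[OF Cs[OF Q(1)] Q(2,3)] by (intro UnionI)
      qed
    qed
    moreover have "w = 1" if "(\<one>, w) \<in> \<Union>\<C>" for w
      using that C(1) unfolding partial_character_def by (elim UnionE) blast
    moreover have "R0 \<subseteq> \<Union>\<C>" using ne C(2) by blast
    ultimately show "\<Union>\<C> \<in> ?A" unfolding partial_character_def by simp
  qed
  then obtain R where R: "partial_character G R" "R0 \<subseteq> R"
    and "\<forall>X\<in>?A. R \<subseteq> X \<longrightarrow> X = R"
    by (elim bexE CollectE conjE)
  hence max: "X = R" if "partial_character G X" "R \<subseteq> X" for X
    using that order_trans[OF R(2) that(2)] by simp
  have s: "subgroup R ?K" using R(1) by (simp add: partial_character_def)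
  have total: "\<exists>z. (x, z) \<in> R" if "x \<in> carrier G" for x
    using partial_character_extend[OF R(1) that] max by metis
  define \<rho> where "\<rho> x = (THE z. (x, z) \<in> R)" for x
  have \<rho>: "\<rho> x = z" if "(x, z) \<in> R" for x z
    unfolding \<rho>_def using that partial_character_unique[OF R(1)] by blast
  have \<rho>R: "(x, \<rho> x) \<in> R" if "x \<in> carrier G" for x using total[OF that] \<rho> by metis
  show ?thesis
  proof (rule that)
    show "\<rho> \<in> hom G circle_group"
    proof (rule homI)
      show "\<rho> x \<in> carrier circle_group" if "x \<in> carrier G" for x
        using \<rho>R[OF that] subgroup.subset[OF s] by auto
      show "\<rho> (x \<otimes> y) = \<rho> x \<otimes>\<^bsub>circle_group\<^esub> \<rho> y" if "x \<in> carrier G" "y \<in> carrier G" for x y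
        using subgroup.m_closed[OF s \<rho>R[OF that(1)] \<rho>R[OF that(2)]] \<rho> by simp
    qed
    show "\<rho> h = \<psi> h" if "h \<in> H" for h using that R(2) by (intro \<rho>) (auto simp: R0_def)
  qed
qed

end

section \<open>Binomial coordinates of a polynomial map\<close>

text \<open>The index \<open>0\<close> does not occur in \<open>binom_sum\<close>; \<open>t 0 = 0\<close> is a normalisation that makes \<open>t\<close> unique.\<close>

definition binom_coeffs :: "nat \<Rightarrow> (rat \<Rightarrow> complex) \<Rightarrow> (nat \<Rightarrow> adele_class) \<Rightarrow> bool" where
  "binom_coeffs n P t \<longleftrightarrow> norm (P 0) = 1 \<and> t 0 = 0 \<and> (\<forall>j>n. t j = 0) \<and>
     (\<forall>q. P q = P 0 * e_Q (binom_sum n t q))"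

text \<open>The degree bound is quantified away so that the sequence depends on \<open>P\<close>
  alone. This makes the coordinates for different degrees compatible.\<close>

definition binom_coeff_seq :: "(rat \<Rightarrow> complex) \<Rightarrow> nat \<Rightarrow> adele_class" where
  "binom_coeff_seq P = (THE t. \<exists>n. binom_coeffs n P t)"

lemma binom_coeffs_mono: "binom_coeffs m P t \<Longrightarrow> m \<le> n \<Longrightarrow> binom_coeffs n P t"
  using binom_sum_mono_neutral[of m n t] unfolding binom_coeffs_def
  by (metis le_less_trans)

lemma binom_coeffs_unique:
  assumes "binom_coeffs m P s" "binom_coeffs n P t"
  shows "s = t"
proof -
  define N where "N = max m n"
  have s: "binom_coeffs N P s" and t: "binom_coeffs N P t"
    using assms binom_coeffs_mono by (auto simp: N_def)
  have "P 0 \<noteq> 0" using s unfolding binom_coeffs_def by (metis norm_zero zero_neq_one)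
  hence "e_Q (binom_sum N s q) = e_Q (binom_sum N t q)" for q
    using s t unfolding binom_coeffs_def by (metis mult_left_cancel)
  hence "e_Q (binom_sum N (\<lambda>j. s j - t j) q) = 1" for q
    using e_Q_add[of "binom_sum N s q" "- binom_sum N t q"]
      e_Q_add[of "binom_sum N t q" "- binom_sum N t q"]
    by (simp add: binom_sum_diff)
  hence "s j - t j = 0" if "1 \<le> j" "j \<le> N" for j
    using binom_sum_unique[of N "\<lambda>j. s j - t j" j] that by blast
  moreover have "s j = t j" if "j = 0 \<or> N < j" for j
    using that s t unfolding binom_coeffs_def by metis
  ultimately show ?thesis by (intro ext) (metis eq_iff_diff_eq_0 less_one not_le)
qed

lemma binom_coeff_seq_eqI: "binom_coeffs n P t \<Longrightarrow> binom_coeff_seq P = t"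
  unfolding binom_coeff_seq_def using binom_coeffs_unique by blast

lemma binom_coeffs_seq:
  assumes "poly_map (Suc n) P"
  shows "binom_coeffs n P (binom_coeff_seq P)"
proof -
  obtain t where t: "\<And>q. P q = P 0 * e_Q (binom_sum n t q)"
    using poly_map_eq_binom_sum[OF assms] by blast
  define s where "s j = (if 1 \<le> j \<and> j \<le> n then t j else 0)" for j
  have "binom_sum n s q = binom_sum n t q" for q by (rule binom_sum_cong) (simp add: s_def)
  hence "binom_coeffs n P s"
    unfolding binom_coeffs_def using poly_map_norm[OF assms] by (metis s_def not_le not_one_le_zero t)
  thus ?thesis using binom_coeff_seq_eqI by metis
qed

lemma binom_coeffs_mult:
  "binom_coeffs n P s \<Longrightarrow> binom_coeffs n Q t \<Longrightarrow> binom_coeffs n (\<lambda>q. P q * Q q) (\<lambda>j. s j + t j)"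
  unfolding binom_coeffs_def binom_sum_add e_Q_add norm_mult
  by (metis (no_types, lifting) add_0 mult_1 mult.assoc mult.left_commute)

text \<open>The entry 0 of \<open>binom_shift\<close> becomes the constant factor in the circle
  through \<open>e_Q\<close>, and is therefore replaced by 0 in the coefficient sequence of the
  derivative.\<close>

lemma binom_coeffs_deriv:
  assumes "binom_coeffs n P t"
  shows "cnj (P 0) * P r = e_Q (binom_shift n t r 0)"
    and "binom_coeffs (n - 1) (\<lambda>q. cnj (P q) * P (q + r))
           (\<lambda>i. if i = 0 then 0 else binom_shift n t r i)"
proof -
  have P: "P q = P 0 * e_Q (binom_sum n t q)" and P0: "norm (P 0) = 1" for q
    using assms unfolding binom_coeffs_def by blast+
  have D: "cnj (P q) * P (q + r)
      = e_Q (binom_shift n t r 0) * e_Q (binom_sum (n - 1) (binom_shift n t r) q)" for q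
  proof -
    have "norm (P q) = 1" by (subst P) (simp add: norm_mult P0)
    hence "cnj (P q) * P q = 1" by (rule cnj_mult_self_unimodular)
    moreover have "P (q + r) = P q *
        (e_Q (binom_shift n t r 0) * e_Q (binom_sum (n - 1) (binom_shift n t r) q))"
      by (subst (1 2) P) (simp add: binom_sum_shift e_Q_add)
    ultimately show ?thesis by (simp flip: mult.assoc)
  qed
  show 0: "cnj (P 0) * P r = e_Q (binom_shift n t r 0)" using D[of 0] by simp
  have "binom_sum (n - 1) (\<lambda>i. if i = 0 then 0 else binom_shift n t r i) q
      = binom_sum (n - 1) (binom_shift n t r) q" for q
    by (rule binom_sum_cong) simp
  moreover have shift_0: "binom_shift n t r i = 0" if "i > n - 1" for i
    using that by (simp add: binom_shift_def)
  ultimately show "binom_coeffs (n - 1) (\<lambda>q. cnj (P q) * P (q + r))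
           (\<lambda>i. if i = 0 then 0 else binom_shift n t r i)"
    unfolding binom_coeffs_def using D 0 shift_0 by auto
qed

section \<open>Circle-valued functions\<close>

text \<open>Functions that are unimodular everywhere, not classes: conjugation is then an exact
  inverse. Compatibility with almost everywhere equality is a property of the evaluation,
  \<open>circle_evaluation_cong\<close>.\<close>

definition circle_functions :: "'x measure \<Rightarrow> ('x \<Rightarrow> complex) monoid" where
  "circle_functions M = \<lparr>carrier = {f \<in> borel_measurable M. \<forall>x. norm (f x) = 1},
     monoid.mult = (\<lambda>f g x. f x * g x), one = (\<lambda>_. 1)\<rparr>"

lemma circle_functions_simps [simp]:
  "f \<in> carrier (circle_functions M) \<longleftrightarrow> f \<in> borel_measurable M \<and> (\<forall>x. norm (f x) = 1)"
  "f \<otimes>\<^bsub>circle_functions M\<^esub> g = (\<lambda>x. f x * g x)"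
  "\<one>\<^bsub>circle_functions M\<^esub> = (\<lambda>_. 1)"
  by (simp_all add: circle_functions_def)

lemma borel_measurable_cnj [measurable]:
  "f \<in> borel_measurable M \<Longrightarrow> (\<lambda>x. cnj (f x)) \<in> borel_measurable M"
  by (rule measurable_compose[OF _ borel_measurable_continuous_onI])
     (auto intro: continuous_intros)

lemma circle_functions_cnj:
  "f \<in> carrier (circle_functions M) \<Longrightarrow> (\<lambda>x. cnj (f x)) \<in> carrier (circle_functions M)"
  by auto

lemma circle_functions_mult:
  "f \<in> carrier (circle_functions M) \<Longrightarrow> g \<in> carrier (circle_functions M) \<Longrightarrow>
   (\<lambda>x. f x * g x) \<in> carrier (circle_functions M)"
  by (auto simp: norm_mult)

lemma comm_group_circle_functions: "comm_group (circle_functions M)"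
proof (rule comm_groupI)
  show "\<exists>g\<in>carrier (circle_functions M). g \<otimes>\<^bsub>circle_functions M\<^esub> f = \<one>\<^bsub>circle_functions M\<^esub>"
    if "f \<in> carrier (circle_functions M)" for f
    using that circle_functions_cnj[OF that]
    by (intro bexI[of _ "\<lambda>x. cnj (f x)"]) (auto simp: cnj_mult_self_unimodular)
qed (auto simp: norm_mult mult_ac)

lemma circle_functions_Linf: "f \<in> carrier (circle_functions M) \<Longrightarrow> f \<in> Linf M"
  by (auto simp: Linf_def intro!: exI[of _ 1])

context prob_space
begin

lemma AE_const_unique:
  assumes "AE x in M. f x = c" "AE x in M. f x = d"
  shows "c = (d :: complex)"
proof -
  have "AE x in M. c = d" using assms by eventually_elim simp
  thus ?thesis by simp
qed

text \<open>A character of the group of circle-valued functions that behaves like evaluation at a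
  point, but does not distinguish functions that agree almost everywhere.\<close>

lemma ex_circle_evaluation:
  "\<exists>\<rho>. \<rho> \<in> hom (circle_functions M) circle_group \<and>
    (\<forall>f \<in> carrier (circle_functions M). \<forall>c. (AE x in M. f x = c) \<longrightarrow> \<rho> f = c)"
proof -
  interpret U: comm_group "circle_functions M" by (rule comm_group_circle_functions)
  define H where "H = {f \<in> carrier (circle_functions M). \<exists>c. AE x in M. f x = c}"
  define \<psi> where "\<psi> f = (THE c. AE x in M. f x = c)" for f :: "'a \<Rightarrow> complex"
  have \<psi>: "\<psi> f = c" if "AE x in M. f x = c" for f c
    unfolding \<psi>_def using that AE_const_unique by blast
  have \<psi>_mult: "AE x in M. f x * g x = \<psi> f * \<psi> g" if "f \<in> H" "g \<in> H" for f g
  proof -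
    obtain c d where c: "AE x in M. f x = c" and d: "AE x in M. g x = d"
      using \<open>f \<in> H\<close> \<open>g \<in> H\<close> by (auto simp: H_def)
    show ?thesis using c d unfolding \<psi>[OF c] \<psi>[OF d] by eventually_elim simp
  qed
  have "subgroup H (circle_functions M)"
  proof (rule U.subgroupI)
    show "H \<subseteq> carrier (circle_functions M)" by (auto simp: H_def)
    have "(\<lambda>_. 1) \<in> H" by (auto simp: H_def)
    thus "H \<noteq> {}" by blast
    fix f assume f: "f \<in> H"
    hence fU: "f \<in> carrier (circle_functions M)" by (simp add: H_def)
    have "inv\<^bsub>circle_functions M\<^esub> f = (\<lambda>x. cnj (f x))"
      using fU circle_functions_cnj[OF fU]
      by (intro U.inv_equality) (auto simp: cnj_mult_self_unimodular)
    moreover obtain c where "AE x in M. f x = c" using f by (auto simp: H_def)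
    hence "AE x in M. cnj (f x) = cnj c" by eventually_elim simp
    ultimately show "inv\<^bsub>circle_functions M\<^esub> f \<in> H"
      using circle_functions_cnj[OF fU] unfolding H_def by auto
    fix g assume g: "g \<in> H"
    show "f \<otimes>\<^bsub>circle_functions M\<^esub> g \<in> H"
      using \<psi>_mult[OF f g] f g circle_functions_mult[of f M g] unfolding H_def by auto
  qed
  moreover have "\<psi> \<in> hom ((circle_functions M)\<lparr>carrier := H\<rparr>) circle_group"
  proof (rule homI)
    fix f assume "f \<in> carrier ((circle_functions M)\<lparr>carrier := H\<rparr>)"
    hence f: "f \<in> H" by simp
    then obtain c where c: "AE x in M. f x = c" by (auto simp: H_def)
    have "AE x in M. norm c = 1" using c by eventually_elim (use f in \<open>auto simp: H_def\<close>)
    thus "\<psi> f \<in> carrier circle_group" using \<psi>[OF c] by simp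
    fix g assume "g \<in> carrier ((circle_functions M)\<lparr>carrier := H\<rparr>)"
    hence g: "g \<in> H" by simp
    show "\<psi> (f \<otimes>\<^bsub>(circle_functions M)\<lparr>carrier := H\<rparr>\<^esub> g) = \<psi> f \<otimes>\<^bsub>circle_group\<^esub> \<psi> g"
      using \<psi>[OF \<psi>_mult[OF f g]] by simp
  qed
  ultimately obtain \<rho> where \<rho>: "\<rho> \<in> hom (circle_functions M) circle_group" "\<And>h. h \<in> H \<Longrightarrow> \<rho> h = \<psi> h"
    by (rule U.circle_character_extend) blast
  have "\<rho> f = c" if "f \<in> carrier (circle_functions M)" "AE x in M. f x = c" for f c
    using \<rho>(2)[of f] \<psi>[OF that(2)] that by (auto simp: H_def)
  thus ?thesis using \<rho>(1) by blast
qed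

definition circle_evaluation :: "('a \<Rightarrow> complex) \<Rightarrow> complex" where
  "circle_evaluation = (SOME \<rho>. \<rho> \<in> hom (circle_functions M) circle_group \<and>
    (\<forall>f \<in> carrier (circle_functions M). \<forall>c. (AE x in M. f x = c) \<longrightarrow> \<rho> f = c))"

lemma circle_evaluation_hom: "circle_evaluation \<in> hom (circle_functions M) circle_group"
  and circle_evaluation_AE_const:
    "f \<in> carrier (circle_functions M) \<Longrightarrow> AE x in M. f x = c \<Longrightarrow> circle_evaluation f = c"
  using someI_ex[OF ex_circle_evaluation] unfolding circle_evaluation_def by blast+

lemma norm_circle_evaluation:
  "f \<in> carrier (circle_functions M) \<Longrightarrow> norm (circle_evaluation f) = 1"
  using hom_in_carrier[OF circle_evaluation_hom] by simp

lemma circle_evaluation_mult: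
  assumes "f \<in> carrier (circle_functions M)" "g \<in> carrier (circle_functions M)"
  shows "circle_evaluation (\<lambda>x. f x * g x) = circle_evaluation f * circle_evaluation g"
  using hom_mult[OF circle_evaluation_hom assms] by simp

lemma circle_evaluation_cnj:
  assumes f: "f \<in> carrier (circle_functions M)"
  shows "circle_evaluation (\<lambda>x. cnj (f x)) = cnj (circle_evaluation f)"
proof -
  have "circle_evaluation (\<lambda>x. cnj (f x) * f x) = 1"
    by (rule circle_evaluation_AE_const[OF circle_functions_mult[OF circle_functions_cnj[OF f] f]])
       (use f in \<open>simp add: cnj_mult_self_unimodular\<close>)
  hence "circle_evaluation (\<lambda>x. cnj (f x)) * circle_evaluation f = 1"
    using circle_evaluation_mult[OF circle_functions_cnj[OF f] f] by simp
  moreover have "cnj (circle_evaluation f) * circle_evaluation f = 1"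
    by (rule cnj_mult_self_unimodular[OF norm_circle_evaluation[OF f]])
  ultimately show ?thesis by (metis mult_right_cancel mult_zero_right zero_neq_one)
qed

text \<open>The quotient \<open>cnj g * f\<close> is almost everywhere the constant 1, so its
  evaluation is 1.\<close>

lemma circle_evaluation_cong:
  assumes f: "f \<in> carrier (circle_functions M)" and g: "g \<in> carrier (circle_functions M)"
    and fg: "AE x in M. f x = g x"
  shows "circle_evaluation f = circle_evaluation g"
proof -
  have "AE x in M. cnj (g x) * f x = 1"
    using fg by eventually_elim (use g in \<open>simp add: cnj_mult_self_unimodular\<close>)
  hence "circle_evaluation (\<lambda>x. cnj (g x) * f x) = 1"
    by (rule circle_evaluation_AE_const[OF circle_functions_mult[OF circle_functions_cnj[OF g] f]])
  hence "cnj (circle_evaluation g) * circle_evaluation f = 1"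
    using circle_evaluation_mult[OF circle_functions_cnj[OF g] f] circle_evaluation_cnj[OF g] by simp
  moreover have "cnj (circle_evaluation g) * circle_evaluation g = 1"
    by (rule cnj_mult_self_unimodular[OF norm_circle_evaluation[OF g]])
  ultimately show ?thesis by (metis mult_left_cancel mult_zero_left zero_neq_one)
qed

end

text \<open>The set \<open>A\<close> quantifies over the whole orbit because ergodicity is stated for strictly invariant sets.\<close>

lemma (in ergodic_Q_system) AE_invariant_lower_bound:
  fixes u :: "'x \<Rightarrow> real"
  assumes u [measurable]: "u \<in> borel_measurable M" and b: "\<And>x. \<bar>u x\<bar> \<le> 1"
    and inv: "\<And>q. AE x in M. u (T q x) = u x"
  shows "AE x in M. expectation u \<le> u x"
proof -
  have sp: "space M = UNIV" using sets_eq_imp_space_eq[OF sets_eq_borel] by simp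
  have int: "integrable M u" by (rule integrable_const_bound[of _ 1]) (use b in auto)
  \<comment> \<open>Countability of the rationals gives one null set for all
    \<open>q\<close>.\<close>
  have allinv: "AE x in M. \<forall>q. u (T q x) = u x" using inv by (simp add: AE_all_countable)
  define A where "A = {x. \<forall>q. u (T q x) < expectation u}"
  have A: "A \<in> sets M"
  proof -
    have [measurable]: "(\<lambda>x. u (T q x)) \<in> borel_measurable M" for q
      using measurable_compose[OF measurable_act u] .
    have "{x \<in> space M. \<forall>q. u (T q x) < expectation u} \<in> sets M" by measurable
    thus ?thesis by (simp add: A_def sp)
  qed
  have "T q -` A = A" for q
  proof -
    have "(\<forall>r. u (T r (T q x)) < expectation u) \<longleftrightarrow> (\<forall>r. u (T r x) < expectation u)" for x
      by (metis act_add diff_add_cancel)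
    thus ?thesis by (auto simp: A_def)
  qed
  hence "measure M A = 0 \<or> measure M A = 1" using ergodic[OF A] by blast
  thus ?thesis
  proof
    assume "measure M A = 0"
    hence "AE x in M. x \<notin> A" using A by (simp add: AE_iff_null null_setsI emeasure_eq_measure sp)
    thus ?thesis using allinv by eventually_elim (auto simp: A_def not_less)
  next
    \<comment> \<open>Impossible: \<open>u\<close> would lie strictly below its own mean almost
      everywhere.\<close>
    assume "measure M A = 1"
    hence "AE x in M. x \<in> A" using A by (simp add: prob_eq_1)
    hence "AE x in M. u x < expectation u"
      using allinv by eventually_elim (auto simp: A_def)
    hence "integral\<^sup>L M u < integral\<^sup>L M (\<lambda>_. expectation u)"
      by (intro integral_less_AE_space int) (auto simp: emeasure_space_1)
    thus ?thesis by (simp add: prob_space)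
  qed
qed

text \<open>The lower bound for \<open>u\<close> and for \<open>- u\<close> makes an invariant
  bounded real function equal to its mean; this applies to the real and imaginary parts of
  \<open>f\<close>.\<close>

lemma (in ergodic_Q_system) AE_invariant_const:
  assumes f: "f \<in> carrier (circle_functions M)" and inv: "\<And>q. AE x in M. f (T q x) = f x"
  obtains c where "AE x in M. f x = c"
proof -
  have real: "AE x in M. u x = expectation u"
    if u: "u \<in> borel_measurable M" "\<And>x. \<bar>u x\<bar> \<le> 1" "\<And>q. AE x in M. u (T q x) = u x" for u :: "'x \<Rightarrow> real"
  proof -
    have "AE x in M. expectation (\<lambda>x. - u x) \<le> - u x"
      by (rule AE_invariant_lower_bound[of "\<lambda>x. - u x"]) (use u in auto)
    moreover have "AE x in M. expectation u \<le> u x" by (rule AE_invariant_lower_bound[OF u])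
    ultimately show ?thesis by eventually_elim simp
  qed
  have fm [measurable]: "f \<in> borel_measurable M" and f1: "norm (f x) = 1" for x using f by auto
  have "AE x in M. Re (f x) = expectation (\<lambda>x. Re (f x))"
  proof (rule real)
    show "(\<lambda>x. Re (f x)) \<in> borel_measurable M" by measurable
    show "\<bar>Re (f x)\<bar> \<le> 1" for x using abs_Re_le_cmod[of "f x"] f1[of x] by simp
    show "AE x in M. Re (f (T q x)) = Re (f x)" for q using inv[of q] by eventually_elim simp
  qed
  moreover have "AE x in M. Im (f x) = expectation (\<lambda>x. Im (f x))"
  proof (rule real)
    show "(\<lambda>x. Im (f x)) \<in> borel_measurable M" by measurable
    show "\<bar>Im (f x)\<bar> \<le> 1" for x using abs_Im_le_cmod[of "f x"] f1[of x] by simp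
    show "AE x in M. Im (f (T q x)) = Im (f x)" for q using inv[of q] by eventually_elim simp
  qed
  ultimately have "AE x in M. f x = Complex (expectation (\<lambda>x. Re (f x))) (expectation (\<lambda>x. Im (f x)))"
    by eventually_elim (simp add: complex_eq_iff)
  thus ?thesis by (rule that)
qed

section \<open>Phase polynomials and their coordinates\<close>

text \<open>The strict bound matches \<open>poly_map\<close> and starts inductions at functions that
  are 1 almost everywhere; degree at most k corresponds to \<open>Suc k\<close>.\<close>

definition phase_degree_less :: "'x measure \<Rightarrow> (rat \<Rightarrow> 'x \<Rightarrow> 'x) \<Rightarrow> nat \<Rightarrow> ('x \<Rightarrow> complex) \<Rightarrow> bool" where
  "phase_degree_less M T n f \<longleftrightarrow> (\<forall>qs. length qs = n \<longrightarrow> (AE x in M. mult_derivs T qs f x = 1))"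

lemma mult_derivs_Nil [simp]: "mult_derivs T [] f = f"
  and mult_derivs_Cons [simp]: "mult_derivs T (q # qs) f = mult_derivs T qs (mult_deriv T q f)"
  by (simp_all add: mult_derivs_def)

lemma mult_derivs_mult:
  "mult_derivs T qs (\<lambda>x. f x * g x) = (\<lambda>x. mult_derivs T qs f x * mult_derivs T qs g x)"
proof (induction qs arbitrary: f g)
  case (Cons q qs)
  have "mult_deriv T q (\<lambda>x. f x * g x) = (\<lambda>x. mult_deriv T q f x * mult_deriv T q g x)"
    by (simp add: mult_deriv_def fun_eq_iff mult_ac)
  thus ?case by (simp add: Cons.IH)
qed simp

lemma mult_derivs_cnj: "mult_derivs T qs (\<lambda>x. cnj (f x)) = (\<lambda>x. cnj (mult_derivs T qs f x))"
proof (induction qs arbitrary: f)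
  case (Cons q qs)
  have "mult_deriv T q (\<lambda>x. cnj (f x)) = (\<lambda>x. cnj (mult_deriv T q f x))"
    by (simp add: mult_deriv_def fun_eq_iff)
  thus ?case by (simp add: Cons.IH)
qed simp

lemma phase_degree_less_mult:
  assumes "phase_degree_less M T n f" "phase_degree_less M T n g"
  shows "phase_degree_less M T n (\<lambda>x. f x * g x)"
  unfolding phase_degree_less_def mult_derivs_mult
proof (intro allI impI)
  fix qs :: "rat list" assume "length qs = n"
  hence "AE x in M. mult_derivs T qs f x = 1" "AE x in M. mult_derivs T qs g x = 1"
    using assms by (auto simp: phase_degree_less_def)
  thus "AE x in M. mult_derivs T qs f x * mult_derivs T qs g x = 1" by eventually_elim simp
qed

lemma phase_degree_less_cnj:
  "phase_degree_less M T n f \<Longrightarrow> phase_degree_less M T n (\<lambda>x. cnj (f x))"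
  unfolding phase_degree_less_def mult_derivs_cnj by (simp add: complex_cnj_cancel_iff[of _ 1, simplified])

lemma phase_degree_less_deriv:
  "phase_degree_less M T (Suc n) f \<Longrightarrow> phase_degree_less M T n (mult_deriv T q f)"
  unfolding phase_degree_less_def by (metis length_Cons mult_derivs_Cons)

section \<open>Circle-valued representatives and orbit maps\<close>

context Q_system
begin

lemma circle_functions_act:
  assumes "f \<in> carrier (circle_functions M)"
  shows "(\<lambda>x. f (T q x)) \<in> carrier (circle_functions M)"
  using assms measurable_compose[OF measurable_act] by auto

lemma circle_functions_deriv:
  assumes "f \<in> carrier (circle_functions M)"
  shows "mult_deriv T q f \<in> carrier (circle_functions M)"
  unfolding mult_deriv_def
  by (rule circle_functions_mult[OF circle_functions_cnj[OF assms] circle_functions_act[OF assms]])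

lemma AE_mult_derivs_cong:
  "AE x in M. f x = g x \<Longrightarrow> AE x in M. mult_derivs T qs f x = mult_derivs T qs g x"
proof (induction qs arbitrary: f g)
  case (Cons q qs)
  have "AE x in M. mult_deriv T q f x = mult_deriv T q g x"
    using Cons.prems AE_act[OF Cons.prems, of q] by eventually_elim (simp add: mult_deriv_def)
  thus ?case using Cons.IH by simp
qed simp

text \<open>A derivative in direction 0 is the squared modulus. Applied with k + 1 zero directions,
  this shows that a phase polynomial, assumed only bounded, is unimodular almost everywhere.\<close>

lemma norm_mult_derivs_0: "norm (mult_derivs T (replicate n 0) f x) = norm (f x) ^ (2 ^ n)"
proof (induction n arbitrary: f)
  case (Suc n)
  thus ?case by (simp add: mult_deriv_def act_zero norm_mult power_mult power2_eq_square)
qed simp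

lemma phase_poly_circle_function:
  assumes g: "phase_poly M T k g"
  obtains f where "f \<in> carrier (circle_functions M)" "AE x in M. f x = g x"
    "phase_degree_less M T (Suc k) f"
proof -
  have gm [measurable]: "g \<in> borel_measurable M" using g by (simp add: phase_poly_def Linf_def)
  have "AE x in M. mult_derivs T (replicate (k + 1) 0) g x = 1"
    using g unfolding phase_poly_def by (metis length_replicate)
  hence g1: "AE x in M. norm (g x) = 1"
  proof eventually_elim
    case (elim x)
    hence "norm (g x) ^ (2 ^ (k + 1)) = 1" using norm_mult_derivs_0[of "k + 1" g x] by simp
    thus ?case using power_eq_imp_eq_base[of "norm (g x)" "2 ^ (k + 1)" 1] by simp
  qed
  \<comment> \<open>The value 1 on the exceptional null set makes \<open>f\<close> unimodular
    everywhere.\<close>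
  define f where "f x = (if norm (g x) = 1 then g x else 1)" for x
  have "f \<in> borel_measurable M" unfolding f_def by measurable
  hence "f \<in> carrier (circle_functions M)" by (simp add: f_def)
  moreover have fg: "AE x in M. f x = g x" using g1 by eventually_elim (simp add: f_def)
  moreover have "phase_degree_less M T (Suc k) f"
    unfolding phase_degree_less_def
  proof (intro allI impI)
    fix qs :: "rat list" assume "length qs = Suc k"
    hence "AE x in M. mult_derivs T qs g x = 1" using g by (simp add: phase_poly_def)
    thus "AE x in M. mult_derivs T qs f x = 1" using AE_mult_derivs_cong[OF fg, of qs]
      by eventually_elim simp
  qed
  ultimately show ?thesis by (rule that)
qed

lemma phase_poly_group_cases:
  assumes "F \<in> carrier (phase_poly_group M T k)"
  obtains f where "f \<in> carrier (circle_functions M)" "phase_degree_less M T (Suc k) f" "F = Linf_class M f"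
proof -
  obtain g where g: "phase_poly M T k g" "F = Linf_class M g" using assms by (auto simp: phase_poly_group_def)
  obtain f where f: "f \<in> carrier (circle_functions M)" "AE x in M. f x = g x"
    "phase_degree_less M T (Suc k) f" using phase_poly_circle_function[OF g(1)] .
  have "F = Linf_class M f"
    using g f Linf_class_eq_iff[of f M g] circle_functions_Linf[OF f(1)] by (simp add: phase_poly_def)
  thus ?thesis using f that by blast
qed

definition orbit_evaluation :: "('x \<Rightarrow> complex) \<Rightarrow> rat \<Rightarrow> complex" where
  "orbit_evaluation f q = circle_evaluation (\<lambda>x. f (T q x))"

lemma orbit_evaluation_0: "orbit_evaluation f 0 = circle_evaluation f"
  by (simp add: orbit_evaluation_def act_zero)

lemma orbit_evaluation_mult:
  "f \<in> carrier (circle_functions M) \<Longrightarrow> g \<in> carrier (circle_functions M) \<Longrightarrow>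
   orbit_evaluation (\<lambda>x. f x * g x) = (\<lambda>q. orbit_evaluation f q * orbit_evaluation g q)"
  unfolding orbit_evaluation_def
  by (intro ext circle_evaluation_mult circle_functions_act)

lemma orbit_evaluation_cnj:
  "f \<in> carrier (circle_functions M) \<Longrightarrow>
   orbit_evaluation (\<lambda>x. cnj (f x)) = (\<lambda>q. cnj (orbit_evaluation f q))"
  unfolding orbit_evaluation_def
  by (intro ext circle_evaluation_cnj circle_functions_act)

lemma orbit_evaluation_act:
  "orbit_evaluation (\<lambda>x. f (T r x)) = (\<lambda>q. orbit_evaluation f (q + r))"
  unfolding orbit_evaluation_def by (subst add.commute) (simp add: act_add)

lemma orbit_evaluation_deriv:
  assumes "f \<in> carrier (circle_functions M)"
  shows "orbit_evaluation (mult_deriv T r f) = (\<lambda>q. cnj (orbit_evaluation f q) * orbit_evaluation f (q + r))"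
  unfolding mult_deriv_def
  using orbit_evaluation_mult[OF circle_functions_cnj[OF assms] circle_functions_act[OF assms]]
    orbit_evaluation_cnj[OF assms] orbit_evaluation_act[of f r]
  by simp

lemma orbit_evaluation_cong:
  assumes "f \<in> carrier (circle_functions M)" "g \<in> carrier (circle_functions M)" "AE x in M. f x = g x"
  shows "orbit_evaluation f = orbit_evaluation g"
  unfolding orbit_evaluation_def
  by (intro ext circle_evaluation_cong circle_functions_act assms(1,2) AE_act[OF assms(3)])

text \<open>By \<open>orbit_evaluation_deriv\<close> each almost everywhere identity for the
  derivatives of \<open>f\<close> becomes an identity in \<open>q\<close>, valid everywhere, for the
  differences of the orbit map.\<close>

lemma poly_map_orbit_evaluation:
  "f \<in> carrier (circle_functions M) \<Longrightarrow> phase_degree_less M T n f \<Longrightarrow> poly_map n (orbit_evaluation f)"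
proof (induction n arbitrary: f)
  case 0
  have f1: "AE x in M. f x = 1" using 0(2) by (simp add: phase_degree_less_def)
  show ?case
    using circle_evaluation_AE_const[OF circle_functions_act[OF 0(1)] AE_act[OF f1]]
    by (simp add: orbit_evaluation_def)
next
  case (Suc n)
  have "poly_map n (orbit_evaluation (mult_deriv T r f))" for r
    by (rule Suc.IH[OF circle_functions_deriv[OF Suc.prems(1)] phase_degree_less_deriv[OF Suc.prems(2)]])
  moreover have "norm (orbit_evaluation f q) = 1" for q
    unfolding orbit_evaluation_def by (rule norm_circle_evaluation[OF circle_functions_act[OF Suc.prems(1)]])
  ultimately show ?case by (simp add: orbit_evaluation_deriv[OF Suc.prems(1)])
qed

section \<open>The coordinate maps\<close>

text \<open>The degree \<open>k\<close> enters only as the length to which one sequence is cut;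
  outside \<open>{1..k}\<close> the value is \<open>undefined\<close>, as the product group
  requires.\<close>

definition phase_coords :: "nat \<Rightarrow> ('x \<Rightarrow> complex) set \<Rightarrow> complex \<times> (nat \<Rightarrow> adele_class)" where
  "phase_coords k F = (let f = SOME f. f \<in> carrier (circle_functions M) \<and> F = Linf_class M f in
     (circle_evaluation f, \<lambda>i\<in>{1..k}. binom_coeff_seq (orbit_evaluation f) i))"

lemma phase_coords_Linf_class:
  assumes f: "f \<in> carrier (circle_functions M)"
  shows "phase_coords k (Linf_class M f) =
    (circle_evaluation f, \<lambda>i\<in>{1..k}. binom_coeff_seq (orbit_evaluation f) i)"
proof -
  define g where "g = (SOME g. g \<in> carrier (circle_functions M) \<and> Linf_class M f = Linf_class M g)"
  have g: "g \<in> carrier (circle_functions M)" "Linf_class M f = Linf_class M g"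
    using someI[of "\<lambda>g. g \<in> carrier (circle_functions M) \<and> Linf_class M f = Linf_class M g" f] f
    unfolding g_def by auto
  have "AE x in M. g x = f x"
    using g(2) Linf_class_eq_iff[OF circle_functions_Linf[OF g(1)] circle_functions_Linf[OF f]] by simp
  thus ?thesis
    using circle_evaluation_cong[OF g(1) f] orbit_evaluation_cong[OF g(1) f]
    unfolding phase_coords_def g_def[symmetric] by (simp add: Let_def)
qed

lemma binom_coeffs_orbit_evaluation:
  assumes "f \<in> carrier (circle_functions M)" "phase_degree_less M T (Suc k) f"
  shows "binom_coeffs k (orbit_evaluation f) (binom_coeff_seq (orbit_evaluation f))"
  by (rule binom_coeffs_seq[OF poly_map_orbit_evaluation[OF assms]])

lemma phase_coords_hom:
  "phase_coords k \<in> hom (phase_poly_group M T k) (circle_group \<times>\<times> adele_class_power k)"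
proof (rule homI)
  fix F assume "F \<in> carrier (phase_poly_group M T k)"
  then obtain f where f: "f \<in> carrier (circle_functions M)" "phase_degree_less M T (Suc k) f"
    "F = Linf_class M f" by (rule phase_poly_group_cases)
  show "phase_coords k F \<in> carrier (circle_group \<times>\<times> adele_class_power k)"
    using norm_circle_evaluation[OF f(1)]
    by (simp add: f(3) phase_coords_Linf_class[OF f(1)] adele_class_power_def adele_class_group_def)
  fix G assume "G \<in> carrier (phase_poly_group M T k)"
  then obtain g where g: "g \<in> carrier (circle_functions M)" "phase_degree_less M T (Suc k) g"
    "G = Linf_class M g" by (rule phase_poly_group_cases)
  have "F \<otimes>\<^bsub>phase_poly_group M T k\<^esub> G = Linf_class M (\<lambda>x. f x * g x)"
    unfolding f(3) g(3) by (rule mult_Linf_class[OF circle_functions_Linf[OF f(1)] circle_functions_Linf[OF g(1)]])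
  moreover have "binom_coeff_seq (orbit_evaluation (\<lambda>x. f x * g x))
      = (\<lambda>j. binom_coeff_seq (orbit_evaluation f) j + binom_coeff_seq (orbit_evaluation g) j)"
    unfolding orbit_evaluation_mult[OF f(1) g(1)]
    by (rule binom_coeff_seq_eqI[OF binom_coeffs_mult[OF binom_coeffs_orbit_evaluation[OF f(1,2)]
          binom_coeffs_orbit_evaluation[OF g(1,2)]]])
  ultimately show "phase_coords k (F \<otimes>\<^bsub>phase_poly_group M T k\<^esub> G) =
      phase_coords k F \<otimes>\<^bsub>circle_group \<times>\<times> adele_class_power k\<^esub> phase_coords k G"
    by (simp add: phase_coords_Linf_class[OF circle_functions_mult[OF f(1) g(1)]] f(3) g(3)
        phase_coords_Linf_class[OF f(1)] phase_coords_Linf_class[OF g(1)]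
        circle_evaluation_mult[OF f(1) g(1)] adele_class_power_def adele_class_group_def
        cong: restrict_cong)
qed

lemma phase_coords_deriv:
  assumes f: "f \<in> carrier (circle_functions M)" "phase_degree_less M T (Suc k) f"
    and t: "phase_coords k (Linf_class M f) = (c, t)"
  shows "phase_coords (k - 1) (class_deriv M T q (Linf_class M f)) =
    (e_Q (binom_shift k t q 0), \<lambda>i\<in>{1..k - 1}. binom_shift k t q i)"
proof -
  let ?P = "orbit_evaluation f"
  note co = binom_coeffs_orbit_evaluation[OF f]
  note df = circle_functions_deriv[OF f(1), of q]
  \<comment> \<open>\<open>t\<close> is \<open>undefined\<close> outside \<open>{1..k}\<close>, but
    \<open>binom_shift k\<close> reads it only at indices between i + 1 and
    \<open>k\<close>.\<close>
  have "t j = binom_coeff_seq ?P j" if "1 \<le> j" "j \<le> k" for j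
    using t that by (auto simp: phase_coords_Linf_class[OF f(1)])
  hence sh: "binom_shift k t q i = binom_shift k (binom_coeff_seq ?P) q i" for i
    unfolding binom_shift_def by (intro sum.cong) auto
  have "binom_coeff_seq (orbit_evaluation (mult_deriv T q f))
      = (\<lambda>i. if i = 0 then 0 else binom_shift k (binom_coeff_seq ?P) q i)"
    unfolding orbit_evaluation_deriv[OF f(1)] by (rule binom_coeff_seq_eqI[OF binom_coeffs_deriv(2)[OF co]])
  moreover have "circle_evaluation (mult_deriv T q f) = e_Q (binom_shift k (binom_coeff_seq ?P) q 0)"
    using binom_coeffs_deriv(1)[OF co, of q] orbit_evaluation_deriv[OF f(1), of q]
    by (simp flip: orbit_evaluation_0)
  ultimately show ?thesis
    by (simp add: class_deriv_Linf_class[OF circle_functions_Linf[OF f(1)]]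
        phase_coords_Linf_class[OF df] sh cong: restrict_cong)
qed

end

lemma (in ergodic_Q_system) orbit_evaluation_eq_1_imp:
  "f \<in> carrier (circle_functions M) \<Longrightarrow> phase_degree_less M T n f \<Longrightarrow>
   (\<And>q. orbit_evaluation f q = 1) \<Longrightarrow> AE x in M. f x = 1"
proof (induction n arbitrary: f)
  case 0
  thus ?case by (simp add: phase_degree_less_def)
next
  case (Suc n)
  have "AE x in M. mult_deriv T r f x = 1" for r
    by (rule Suc.IH[OF circle_functions_deriv[OF Suc.prems(1)] phase_degree_less_deriv[OF Suc.prems(2)]])
       (simp add: orbit_evaluation_deriv[OF Suc.prems(1)] Suc.prems(3))
  hence "AE x in M. f (T r x) = f x" for r
  proof (rule AE_mp, intro AE_I2 impI)
    fix x assume "mult_deriv T r f x = 1"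
    hence "cnj (f x) * f (T r x) = 1" by (simp add: mult_deriv_def)
    moreover have "cnj (f x) * f x = 1"
      using Suc.prems(1) by (simp add: cnj_mult_self_unimodular)
    ultimately show "f (T r x) = f x" by (metis mult_left_cancel mult_zero_left zero_neq_one)
  qed
  then obtain c where c: "AE x in M. f x = c" using AE_invariant_const[OF Suc.prems(1)] by blast
  have "c = 1"
    using circle_evaluation_AE_const[OF Suc.prems(1) c] Suc.prems(3)[of 0] by (simp add: orbit_evaluation_0)
  thus ?case using c by simp
qed

text \<open>Equal coordinates give equal orbit maps, so \<open>cnj g * f\<close> has orbit map 1;
  the kernel argument is carried out on this representative.\<close>

lemma (in ergodic_Q_system) phase_coords_inj:
  "inj_on (phase_coords k) (carrier (phase_poly_group M T k))"
proof (rule inj_onI)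
  fix F G assume "F \<in> carrier (phase_poly_group M T k)" "G \<in> carrier (phase_poly_group M T k)"
    and eq: "phase_coords k F = phase_coords k G"
  then obtain f g where f: "f \<in> carrier (circle_functions M)" "phase_degree_less M T (Suc k) f"
    "F = Linf_class M f" and g: "g \<in> carrier (circle_functions M)" "phase_degree_less M T (Suc k) g"
    "G = Linf_class M g" by (metis phase_poly_group_cases)
  have ev: "circle_evaluation f = circle_evaluation g"
    and r: "(\<lambda>i\<in>{1..k}. binom_coeff_seq (orbit_evaluation f) i) = (\<lambda>i\<in>{1..k}. binom_coeff_seq (orbit_evaluation g) i)"
    using eq unfolding f(3) g(3) phase_coords_Linf_class[OF f(1)] phase_coords_Linf_class[OF g(1)]
    by simp_all
  have "binom_coeff_seq (orbit_evaluation f) j = binom_coeff_seq (orbit_evaluation g) j" if "1 \<le> j" "j \<le> k" for j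
    using fun_cong[OF r, of j] that by simp
  hence "binom_sum k (binom_coeff_seq (orbit_evaluation f)) q = binom_sum k (binom_coeff_seq (orbit_evaluation g)) q" for q
    by (rule binom_sum_cong)
  hence "orbit_evaluation f q = orbit_evaluation g q" for q
    using binom_coeffs_orbit_evaluation[OF f(1,2)] binom_coeffs_orbit_evaluation[OF g(1,2)] ev
    unfolding binom_coeffs_def orbit_evaluation_0 by metis
  hence P: "orbit_evaluation (\<lambda>x. cnj (g x) * f x) q = 1" for q
    unfolding orbit_evaluation_mult[OF circle_functions_cnj[OF g(1)] f(1)] orbit_evaluation_cnj[OF g(1)]
    using norm_circle_evaluation[OF circle_functions_act[OF g(1)], of q]
    by (simp add: cnj_mult_self_unimodular flip: orbit_evaluation_def)
  have "AE x in M. cnj (g x) * f x = 1"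
    by (rule orbit_evaluation_eq_1_imp[OF circle_functions_mult[OF circle_functions_cnj[OF g(1)] f(1)]
          phase_degree_less_mult[OF phase_degree_less_cnj[OF g(2)] f(2)] P])
  hence "AE x in M. f x = g x"
  proof (rule AE_mp, intro AE_I2 impI)
    fix x assume "cnj (g x) * f x = 1"
    moreover have "cnj (g x) * g x = 1" using g(1) by (simp add: cnj_mult_self_unimodular)
    ultimately show "f x = g x" by (metis mult_left_cancel mult_zero_left zero_neq_one)
  qed
  thus "F = G"
    unfolding f(3) g(3)
    using Linf_class_eq_iff[OF circle_functions_Linf[OF f(1)] circle_functions_Linf[OF g(1)]] by simp
qed

theorem theorem9p1:
  fixes M :: "'x::metric_space measure" and T :: "rat \<Rightarrow> 'x \<Rightarrow> 'x"
  assumes "ergodic_Q_system M T"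
  shows "\<exists>\<phi> :: nat \<Rightarrow> ('x \<Rightarrow> complex) set \<Rightarrow> complex \<times> (nat \<Rightarrow> adele_class).
    (\<forall>k. \<phi> k \<in> hom (phase_poly_group M T k) (circle_group \<times>\<times> adele_class_power k) \<and>
         inj_on (\<phi> k) (carrier (phase_poly_group M T k))) \<and>
    (\<forall>c. norm c = 1 \<longrightarrow> \<phi> 0 (Linf_class M (\<lambda>_. c)) = (c, \<one>\<^bsub>adele_class_power 0\<^esub>)) \<and>
    (\<forall>k j. j \<le> k \<longrightarrow> (\<forall>f \<in> carrier (phase_poly_group M T j).
         \<phi> k f = (fst (\<phi> j f), \<lambda>i\<in>{1..k}. if i \<le> j then snd (\<phi> j f) i else 0))) \<and>
    (\<forall>k\<ge>1. \<forall>f \<in> carrier (phase_poly_group M T k). \<forall>c t. \<phi> k f = (c, t) \<longrightarrow>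
         (\<forall>q. let t' = (\<lambda>i. \<Sum>j=i+1..k. (q gchoose (j - i)) *\<^sub>Q t j) in
              \<phi> (k - 1) (class_deriv M T q f) = (e_Q (t' 0), \<lambda>i\<in>{1..k - 1}. t' i)))"
proof -
  interpret ergodic_Q_system M T by fact
  show ?thesis
  proof (intro exI[of _ phase_coords] conjI allI impI ballI)
    fix k
    show "phase_coords k \<in> hom (phase_poly_group M T k) (circle_group \<times>\<times> adele_class_power k)"
      by (rule phase_coords_hom)
    show "inj_on (phase_coords k) (carrier (phase_poly_group M T k))"
      by (rule phase_coords_inj)
  next
    fix c :: complex assume "norm c = 1"
    hence c: "(\<lambda>_. c) \<in> carrier (circle_functions M)" by simp
    show "phase_coords 0 (Linf_class M (\<lambda>_. c)) = (c, \<one>\<^bsub>adele_class_power 0\<^esub>)"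
      using circle_evaluation_AE_const[OF c, of c]
      by (simp add: phase_coords_Linf_class[OF c] adele_class_power_def restrict_def)
  next
    fix k j F assume "j \<le> k" "F \<in> carrier (phase_poly_group M T j)"
    then obtain f where f: "f \<in> carrier (circle_functions M)" "phase_degree_less M T (Suc j) f"
      "F = Linf_class M f" by (metis phase_poly_group_cases)
    \<comment> \<open>Both sides cut the same sequence; the degree bound \<open>j\<close> and the
      normalisation in \<open>binom_coeffs\<close> make it vanish beyond \<open>j\<close>.\<close>
    have "binom_coeff_seq (orbit_evaluation f) i = 0" if "i > j" for i
      using binom_coeffs_orbit_evaluation[OF f(1,2)] that unfolding binom_coeffs_def by blast
    thus "phase_coords k F = (fst (phase_coords j F),
        \<lambda>i\<in>{1..k}. if i \<le> j then snd (phase_coords j F) i else 0)"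
      unfolding f(3) phase_coords_Linf_class[OF f(1)] by (auto intro!: restrict_ext)
  next
    fix k F c t q assume "F \<in> carrier (phase_poly_group M T k)" and t: "phase_coords k F = (c, t)"
    then obtain f where f: "f \<in> carrier (circle_functions M)" "phase_degree_less M T (Suc k) f"
      "F = Linf_class M f" by (metis phase_poly_group_cases)
    show "let t' = \<lambda>i. \<Sum>j=i+1..k. (q gchoose (j - i)) *\<^sub>Q t j in
        phase_coords (k - 1) (class_deriv M T q F) = (e_Q (t' 0), \<lambda>i\<in>{1..k - 1}. t' i)"
      using phase_coords_deriv[OF f(1,2) t[unfolded f(3)], of q]
      unfolding Let_def f(3) binom_shift_def .
  qed
qed

end
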